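(* Let $A\in\mathcal{V}$ and let $\theta,\chi\in Con(A)$ with $\theta\subseteq\chi$ and $Max(A)\cap[\theta)_A=Max(A)\cap[\chi)_A$. If $\chi$ has $CBLP$ then $\theta$ has $CBLP$.
   Context: $\mathcal{V}$ is a congruence modular, semidegenerate variety (no nontrivial algebra has a one-element subalgebra) of finite signature. For $B\in\mathcal{V}$: $Con(B)$ is its congruence lattice with bounds $\Delta_B,\nabla_B$, $[\cdot,\cdot]$ the Freese–McKenzie commutator, $K(B)$ the compact congruences. A congruence $\phi\neq\nabla_B$ is prime if $[\alpha,\beta]\subseteq\phi$ implies $\alpha\subseteq\phi$ or $\beta\subseteq\phi$; $\rho(\theta)$ is the intersection of prime congruences containing $\theta$; $Max(B)$ is the set of maximal congruences; $[\theta)_B=\{\chi\in Con(B):\theta\subseteq\chi\}$. $B(Con(B))$ is the Boolean algebra of complemented elements of $Con(B)$. When $K(B)$ is closed under the commutator, the reticulation $L(B)=K(B)/{\equiv}$ ($\alpha\equiv\beta$ iff $\rho(\alpha)=\rho(\beta)$) is a bounded distributive lattice with canonical map $\lambda_B$, mapping $B(Con(B))$ injectively into $B(L(B))$; the reticulation preserves the Boolean center if this map is onto $B(L(B))$. Standing assumption: for every $B\in\mathcal{V}$, $K(B)$ is closed under the commutator and the reticulation of $B$ preserves the Boolean center. A congruence $\theta$ of $A$ has $CBLP$ if for every $\beta\in B(Con(A/\theta))$ there is $\alpha\in B(Con(A))$ with $(\alpha\vee\theta)/\theta=\beta$. *)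

theory Defs
  imports Main
begin

text \<open>An algebra: a carrier set and interpretations of the operation symbols
  (an operation symbol f of arity ar f is applied to lists of length ar f).\<close>

record ('f, 'a) alg =
  carr :: "'a set"
  ops  :: "'f \<Rightarrow> 'a list \<Rightarrow> 'a"

definition is_alg :: "('f \<Rightarrow> nat) \<Rightarrow> ('f, 'a) alg \<Rightarrow> bool" where
  "is_alg ar B \<longleftrightarrow> carr B \<noteq> {} \<and>
     (\<forall>f xs. length xs = ar f \<and> set xs \<subseteq> carr B \<longrightarrow> ops B f xs \<in> carr B)"

datatype ('f, 'v) trm = Var 'v | App 'f "('f, 'v) trm list"

fun wf_trm :: "('f \<Rightarrow> nat) \<Rightarrow> ('f, 'v) trm \<Rightarrow> bool" where
  "wf_trm ar (Var v) = True"
| "wf_trm ar (App f ts) = (length ts = ar f \<and> (\<forall>t\<in>set ts. wf_trm ar t))"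

fun eval :: "('f, 'a) alg \<Rightarrow> ('v \<Rightarrow> 'a) \<Rightarrow> ('f, 'v) trm \<Rightarrow> 'a" where
  "eval B s (Var v) = s v"
| "eval B s (App f ts) = ops B f (map (eval B s) ts)"

definition in_var :: "('f \<Rightarrow> nat) \<Rightarrow> (('f, nat) trm \<times> ('f, nat) trm) set \<Rightarrow> ('f, 'a) alg \<Rightarrow> bool" where
  "in_var ar E B \<longleftrightarrow> is_alg ar B \<and>
     (\<forall>(s, t)\<in>E. \<forall>\<sigma>. range \<sigma> \<subseteq> carr B \<longrightarrow> eval B \<sigma> s = eval B \<sigma> t)"

definition Con :: "('f \<Rightarrow> nat) \<Rightarrow> ('f, 'a) alg \<Rightarrow> ('a \<times> 'a) set set" where
  "Con ar B = {\<theta>. equiv (carr B) \<theta> \<and>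
     (\<forall>f xs ys. length xs = ar f \<and> length ys = ar f \<and> list_all2 (\<lambda>x y. (x, y) \<in> \<theta>) xs ys
        \<longrightarrow> (ops B f xs, ops B f ys) \<in> \<theta>)}"

definition Delta :: "('f, 'a) alg \<Rightarrow> ('a \<times> 'a) set" where
  "Delta B = Id_on (carr B)"

definition Nabla :: "('f, 'a) alg \<Rightarrow> ('a \<times> 'a) set" where
  "Nabla B = carr B \<times> carr B"

definition Cg :: "('f \<Rightarrow> nat) \<Rightarrow> ('f, 'a) alg \<Rightarrow> ('a \<times> 'a) set \<Rightarrow> ('a \<times> 'a) set" where
  "Cg ar B X = \<Inter>{\<theta> \<in> Con ar B. X \<subseteq> \<theta>}"

definition cjoin :: "('f \<Rightarrow> nat) \<Rightarrow> ('f, 'a) alg \<Rightarrow> ('a \<times> 'a) set \<Rightarrow> ('a \<times> 'a) set \<Rightarrow> ('a \<times> 'a) set" where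
  "cjoin ar B \<alpha> \<beta> = Cg ar B (\<alpha> \<union> \<beta>)"

definition cJoin :: "('f \<Rightarrow> nat) \<Rightarrow> ('f, 'a) alg \<Rightarrow> ('a \<times> 'a) set set \<Rightarrow> ('a \<times> 'a) set" where
  "cJoin ar B S = Cg ar B (\<Union>S)"

definition K :: "('f \<Rightarrow> nat) \<Rightarrow> ('f, 'a) alg \<Rightarrow> ('a \<times> 'a) set set" where
  "K ar B = {\<theta> \<in> Con ar B. \<forall>S \<subseteq> Con ar B. \<theta> \<subseteq> cJoin ar B S \<longrightarrow>
       (\<exists>S'. S' \<subseteq> S \<and> finite S' \<and> \<theta> \<subseteq> cJoin ar B S')}"

section \<open>The (Freese--McKenzie) commutator, via the term condition\<close>

text \<open>C(alpha, beta; delta): alpha centralizes beta modulo delta (term condition).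
  Variables Inl i form the tuple x, variables Inr j the tuple y of t(x, y).\<close>
definition centralizes :: "('f \<Rightarrow> nat) \<Rightarrow> ('f, 'a) alg \<Rightarrow> ('a \<times> 'a) set \<Rightarrow> ('a \<times> 'a) set \<Rightarrow> ('a \<times> 'a) set \<Rightarrow> bool" where
  "centralizes ar B \<alpha> \<beta> \<delta> \<longleftrightarrow>
     (\<forall>(t :: ('f, nat + nat) trm) a b c d. wf_trm ar t \<longrightarrow>
        (\<forall>i. (a i, b i) \<in> \<alpha>) \<longrightarrow> (\<forall>j. (c j, d j) \<in> \<beta>) \<longrightarrow>
        (eval B (case_sum a c) t, eval B (case_sum a d) t) \<in> \<delta> \<longrightarrow>
        (eval B (case_sum b c) t, eval B (case_sum b d) t) \<in> \<delta>)"

definition comm :: "('f \<Rightarrow> nat) \<Rightarrow> ('f, 'a) alg \<Rightarrow> ('a \<times> 'a) set \<Rightarrow> ('a \<times> 'a) set \<Rightarrow> ('a \<times> 'a) set" where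
  "comm ar B \<alpha> \<beta> = \<Inter>{\<delta> \<in> Con ar B. centralizes ar B \<alpha> \<beta> \<delta>}"

definition prime_con :: "('f \<Rightarrow> nat) \<Rightarrow> ('f, 'a) alg \<Rightarrow> ('a \<times> 'a) set \<Rightarrow> bool" where
  "prime_con ar B \<phi> \<longleftrightarrow> \<phi> \<in> Con ar B \<and> \<phi> \<noteq> Nabla B \<and>
     (\<forall>\<alpha>\<in>Con ar B. \<forall>\<beta>\<in>Con ar B. comm ar B \<alpha> \<beta> \<subseteq> \<phi> \<longrightarrow> \<alpha> \<subseteq> \<phi> \<or> \<beta> \<subseteq> \<phi>)"

text \<open>rho(theta): intersection of the prime congruences containing theta
  (the empty intersection being Nabla).\<close>
definition rho :: "('f \<Rightarrow> nat) \<Rightarrow> ('f, 'a) alg \<Rightarrow> ('a \<times> 'a) set \<Rightarrow> ('a \<times> 'a) set" where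
  "rho ar B \<theta> = Nabla B \<inter> \<Inter>{\<phi>. prime_con ar B \<phi> \<and> \<theta> \<subseteq> \<phi>}"

definition MaxCon :: "('f \<Rightarrow> nat) \<Rightarrow> ('f, 'a) alg \<Rightarrow> ('a \<times> 'a) set set" where
  "MaxCon ar B = {\<mu> \<in> Con ar B. \<mu> \<noteq> Nabla B \<and>
     (\<forall>\<psi>\<in>Con ar B. \<mu> \<subseteq> \<psi> \<longrightarrow> \<psi> = \<mu> \<or> \<psi> = Nabla B)}"

definition BCon :: "('f \<Rightarrow> nat) \<Rightarrow> ('f, 'a) alg \<Rightarrow> ('a \<times> 'a) set set" where
  "BCon ar B = {\<alpha> \<in> Con ar B. \<exists>\<beta>\<in>Con ar B. \<alpha> \<inter> \<beta> = Delta B \<and> cjoin ar B \<alpha> \<beta> = Nabla B}"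

text \<open>L(B) = K(B)/\<equiv> with [a] join [b] = [a join b], [a] meet [b] = [[a,b]],
  0 = [Delta], 1 = [Nabla], where a \<equiv> b iff rho a = rho b.  The class of a compact
  alpha is a Boolean element of L(B) iff it has a complement in L(B).\<close>
definition ret_boolean :: "('f \<Rightarrow> nat) \<Rightarrow> ('f, 'a) alg \<Rightarrow> ('a \<times> 'a) set \<Rightarrow> bool" where
  "ret_boolean ar B \<alpha> \<longleftrightarrow> \<alpha> \<in> K ar B \<and>
     (\<exists>\<beta>\<in>K ar B. rho ar B (cjoin ar B \<alpha> \<beta>) = rho ar B (Nabla B) \<and>
                  rho ar B (comm ar B \<alpha> \<beta>) = rho ar B (Delta B))"

text \<open>lambda_B maps B(Con(B)) onto B(L(B)): every Boolean class [alpha] of L(B)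
  equals lambda_B(gamma) = [gamma] for some gamma in B(Con(B)).\<close>
definition ret_preserves_bc :: "('f \<Rightarrow> nat) \<Rightarrow> ('f, 'a) alg \<Rightarrow> bool" where
  "ret_preserves_bc ar B \<longleftrightarrow>
     (\<forall>\<alpha>. ret_boolean ar B \<alpha> \<longrightarrow>
        (\<exists>\<gamma>\<in>BCon ar B. \<gamma> \<in> K ar B \<and> rho ar B \<gamma> = rho ar B \<alpha>))"

definition quot_alg :: "('f, 'a) alg \<Rightarrow> ('a \<times> 'a) set \<Rightarrow> ('f, 'a set) alg" where
  "quot_alg A \<theta> = \<lparr> carr = carr A // \<theta>,
     ops = (\<lambda>f Xs. \<theta> `` {ops A f (map (\<lambda>X. SOME x. x \<in> X) Xs)}) \<rparr>"

definition quot_con :: "('a \<times> 'a) set \<Rightarrow> ('a \<times> 'a) set \<Rightarrow> ('a set \<times> 'a set) set" where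
  "quot_con \<theta> \<alpha> = {(\<theta> `` {x}, \<theta> `` {y}) | x y. (x, y) \<in> \<alpha>}"

definition CBLP :: "('f \<Rightarrow> nat) \<Rightarrow> ('f, 'a) alg \<Rightarrow> ('a \<times> 'a) set \<Rightarrow> bool" where
  "CBLP ar A \<theta> \<longleftrightarrow>
     (\<forall>\<beta>\<in>BCon ar (quot_alg A \<theta>). \<exists>\<alpha>\<in>BCon ar A. quot_con \<theta> (cjoin ar A \<alpha> \<theta>) = \<beta>)"

definition modular_con :: "('f \<Rightarrow> nat) \<Rightarrow> ('f, 'a) alg \<Rightarrow> bool" where
  "modular_con ar B \<longleftrightarrow> (\<forall>\<alpha>\<in>Con ar B. \<forall>\<beta>\<in>Con ar B. \<forall>\<gamma>\<in>Con ar B.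
     \<alpha> \<subseteq> \<gamma> \<longrightarrow> cjoin ar B \<alpha> (\<beta> \<inter> \<gamma>) = cjoin ar B \<alpha> \<beta> \<inter> \<gamma>)"

definition one_elem_subalg :: "('f \<Rightarrow> nat) \<Rightarrow> ('f, 'a) alg \<Rightarrow> bool" where
  "one_elem_subalg ar B \<longleftrightarrow> (\<exists>x\<in>carr B. \<forall>f. ops B f (replicate (ar f) x) = x)"

definition nontrivial :: "('f, 'a) alg \<Rightarrow> bool" where
  "nontrivial B \<longleftrightarrow> (\<exists>x\<in>carr B. \<exists>y\<in>carr B. x \<noteq> y)"

end

theory Submission
  imports Defs
begin

text \<open>
  The key fact is that comaximal congruences \<alpha>, \<beta> with \<alpha> \<inter> \<beta> \<subseteq> \<chi> satisfy (\<alpha> \<or> \<chi>) \<inter> (\<beta> \<or> \<chi>) = \<chi>. Let \<psi> be the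
  left-hand side and write A(\<alpha>), A(\<psi>) for \<alpha>, \<psi> as subalgebras of A \<times> A. Let D be the congruence of A(\<alpha>)
  generated by the coordinatewise \<beta> and the coordinatewise \<chi>. By the shifting lemma for A, no class of D
  meets both \<chi> and its complement. A pair ((a, c), (b, d)) of D is a 2 \<times> 2 matrix; since \<psi> \<subseteq> \<beta> \<or> \<chi>, transposing
  these matrices gives a tolerance of A(\<psi>) that relates (x, x) to (y, y) for (x, y) \<in> \<alpha>, and the shifting lemma for
  A(\<alpha>) shows that it does not lead out of \<chi> either. Exchange \<alpha> and \<beta> for a second tolerance. Together the two generate
  a congruence of A(\<psi>) that collapses the diagonal to a one-element subalgebra of the quotient; by
  semidegeneracy it is everything, so \<psi> \<subseteq> \<chi>.

  Semidegeneracy and the finite signature also put every proper congruence below a maximal one.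
  If now \<phi> and \<psi> are complements over \<theta>, then \<phi> \<or> \<chi> and \<psi> \<or> \<chi> are complements over \<chi> by the key fact, hence
  \<phi> \<or> \<chi> = \<gamma> \<or> \<chi> for some \<gamma> with complement \<gamma>'. A maximal congruence above \<theta> contains \<chi>, so it contains
  \<phi> iff it contains \<gamma>. Therefore \<psi> \<or> \<gamma> \<or> \<theta> = \<nabla> and \<gamma>' \<or> \<phi> = \<nabla>, and the key fact turns these into
  \<phi> \<subseteq> \<gamma> \<or> \<theta> and \<gamma> \<subseteq> \<phi>.
\<close>

section \<open>Tolerances and congruences\<close>

definition Tol :: "('f \<Rightarrow> nat) \<Rightarrow> ('f, 'a) alg \<Rightarrow> ('a \<times> 'a) set set" where
  "Tol ar B = {R. R \<subseteq> carr B \<times> carr B \<and> refl_on (carr B) R \<and> sym R \<and>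
     (\<forall>f xs ys. length xs = ar f \<and> length ys = ar f \<and> list_all2 (\<lambda>x y. (x, y) \<in> R) xs ys
        \<longrightarrow> (ops B f xs, ops B f ys) \<in> R)}"

lemma Con_iff_Tol: "\<theta> \<in> Con ar B \<longleftrightarrow> \<theta> \<in> Tol ar B \<and> trans \<theta>"
  by (auto simp: Con_def Tol_def equiv_def)

lemma Con_imp_Tol: "\<theta> \<in> Con ar B \<Longrightarrow> \<theta> \<in> Tol ar B"
  by (simp add: Con_iff_Tol)

lemma TolI:
  assumes "R \<subseteq> carr B \<times> carr B"
    and "\<And>x. x \<in> carr B \<Longrightarrow> (x, x) \<in> R"
    and "\<And>x y. (x, y) \<in> R \<Longrightarrow> (y, x) \<in> R"
    and "\<And>f xs ys. length xs = ar f \<Longrightarrow> length ys = ar f \<Longrightarrow>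
           list_all2 (\<lambda>x y. (x, y) \<in> R) xs ys \<Longrightarrow> (ops B f xs, ops B f ys) \<in> R"
  shows "R \<in> Tol ar B"
  using assms by (auto simp: Tol_def refl_on_def intro: symI)

lemma ConI:
  assumes "\<theta> \<in> Tol ar B" and "\<And>x y z. (x, y) \<in> \<theta> \<Longrightarrow> (y, z) \<in> \<theta> \<Longrightarrow> (x, z) \<in> \<theta>"
  shows "\<theta> \<in> Con ar B"
  using assms by (auto simp: Con_iff_Tol intro: transI)

lemma Tol_subset: "R \<in> Tol ar B \<Longrightarrow> R \<subseteq> carr B \<times> carr B"
  by (simp add: Tol_def)

lemma Tol_carr: "R \<in> Tol ar B \<Longrightarrow> (x, y) \<in> R \<Longrightarrow> x \<in> carr B \<and> y \<in> carr B"
  by (auto simp: Tol_def)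

lemma Tol_refl: "R \<in> Tol ar B \<Longrightarrow> x \<in> carr B \<Longrightarrow> (x, x) \<in> R"
  by (auto simp: Tol_def refl_on_def)

lemma Tol_sym: "R \<in> Tol ar B \<Longrightarrow> (x, y) \<in> R \<Longrightarrow> (y, x) \<in> R"
  by (auto simp: Tol_def dest: symD)

lemma Tol_ops:
  "R \<in> Tol ar B \<Longrightarrow> length xs = ar f \<Longrightarrow> length ys = ar f \<Longrightarrow>
   list_all2 (\<lambda>x y. (x, y) \<in> R) xs ys \<Longrightarrow> (ops B f xs, ops B f ys) \<in> R"
  by (simp add: Tol_def)

lemmas Con_subset = Tol_subset[OF Con_imp_Tol]
lemmas Con_carr = Tol_carr[OF Con_imp_Tol]
lemmas Con_refl = Tol_refl[OF Con_imp_Tol]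
lemmas Con_sym = Tol_sym[OF Con_imp_Tol]
lemmas Con_ops = Tol_ops[OF Con_imp_Tol]

lemma Con_trans: "\<theta> \<in> Con ar B \<Longrightarrow> (x, y) \<in> \<theta> \<Longrightarrow> (y, z) \<in> \<theta> \<Longrightarrow> (x, z) \<in> \<theta>"
  by (auto simp: Con_iff_Tol dest: transD)

lemma is_alg_ops: "is_alg ar B \<Longrightarrow> length xs = ar f \<Longrightarrow> set xs \<subseteq> carr B \<Longrightarrow> ops B f xs \<in> carr B"
  by (simp add: is_alg_def)

lemma list_all2_carr:
  assumes "\<theta> \<subseteq> carr B \<times> carr B" "list_all2 (\<lambda>x y. (x, y) \<in> \<theta>) xs ys"
  shows "set xs \<subseteq> carr B" "set ys \<subseteq> carr B"
  using assms(2,1) by (induction xs ys rule: list_all2_induct) auto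

lemma Nabla_Con:
  assumes "is_alg ar B"
  shows "Nabla B \<in> Con ar B"
proof (intro ConI TolI)
  fix f xs ys
  assume "length xs = ar f" "length ys = ar f" "list_all2 (\<lambda>x y. (x, y) \<in> Nabla B) xs ys"
  then show "(ops B f xs, ops B f ys) \<in> Nabla B"
    using list_all2_carr[of "Nabla B" B xs ys] assms by (auto simp: Nabla_def intro!: is_alg_ops)
qed (auto simp: Nabla_def)

lemma Con_le_Nabla: "\<theta> \<in> Con ar B \<Longrightarrow> \<theta> \<subseteq> Nabla B"
  unfolding Nabla_def by (rule Con_subset)

lemma Con_eq_Nabla: "\<theta> \<in> Con ar B \<Longrightarrow> Nabla B \<subseteq> \<theta> \<Longrightarrow> \<theta> = Nabla B"
  by (simp add: Con_le_Nabla subset_antisym)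

lemma Delta_Con:
  assumes "is_alg ar B"
  shows "Delta B \<in> Con ar B"
proof (intro ConI TolI)
  fix f xs ys
  assume len: "length xs = ar f" and rel: "list_all2 (\<lambda>x y. (x, y) \<in> Delta B) xs ys"
  have "xs = ys \<and> set xs \<subseteq> carr B"
    using rel by (induction xs ys rule: list_all2_induct) (auto simp: Delta_def)
  then show "(ops B f xs, ops B f ys) \<in> Delta B"
    using is_alg_ops[OF assms len] by (auto simp: Delta_def)
qed (auto simp: Delta_def)

lemma Delta_le_Con: "\<theta> \<in> Con ar B \<Longrightarrow> Delta B \<subseteq> \<theta>"
  by (auto simp: Delta_def intro: Con_refl)

lemma Int_Con:
  assumes \<alpha>: "\<alpha> \<in> Con ar B" and \<beta>: "\<beta> \<in> Con ar B"
  shows "\<alpha> \<inter> \<beta> \<in> Con ar B"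
proof (intro ConI TolI)
  show "(x, z) \<in> \<alpha> \<inter> \<beta>" if "(x, y) \<in> \<alpha> \<inter> \<beta>" "(y, z) \<in> \<alpha> \<inter> \<beta>" for x y z
    using that Con_trans[OF \<alpha>] Con_trans[OF \<beta>] by blast
  fix f xs ys
  assume "length xs = ar f" "length ys = ar f" "list_all2 (\<lambda>x y. (x, y) \<in> \<alpha> \<inter> \<beta>) xs ys"
  then show "(ops B f xs, ops B f ys) \<in> \<alpha> \<inter> \<beta>"
    using Con_ops[OF \<alpha>, of xs f ys] Con_ops[OF \<beta>, of xs f ys] by (auto simp: list_all2_iff)
qed (use Con_carr[OF \<alpha>] Con_refl[OF \<alpha>] Con_refl[OF \<beta>] Con_sym[OF \<alpha>] Con_sym[OF \<beta>] in auto)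

lemma trancl_Union_Tol_ops:
  assumes Tol: "S \<subseteq> Tol ar B" and ne: "S \<noteq> {}"
    and len: "length xs = ar f" and carr: "set xs \<subseteq> carr B"
    and rel: "list_all2 (\<lambda>x y. (x, y) \<in> (\<Union>S)\<^sup>+) xs ys"
  shows "(ops B f xs, ops B f ys) \<in> (\<Union>S)\<^sup>+"
proof -
  have refl_list: "list_all2 (\<lambda>x y. (x, y) \<in> R) zs zs" if "R \<in> S" "set zs \<subseteq> carr B" for R zs
    using that Tol by (auto simp: list_all2_same intro!: Tol_refl)
  have "(xs, ys) \<in> (listrel1 (\<Union>S))\<^sup>*"
    using rel unfolding listrel_rtrancl_eq_rtrancl_listrel1[symmetric] listrel_iff_zip
    by (auto simp: list_all2_iff intro: trancl_into_rtrancl)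
  then have "length ys = ar f \<and> set ys \<subseteq> carr B \<and> (ops B f xs, ops B f ys) \<in> (\<Union>S)\<^sup>+"
  proof (induction rule: rtrancl_induct)
    case base
    obtain R where R: "R \<in> S" using ne by blast
    then have "(ops B f xs, ops B f xs) \<in> R"
      using Tol len refl_list[OF R carr] by (blast intro: Tol_ops)
    then show ?case using len carr R by blast
  next
    case (step ys zs)
    then obtain x y us vs where "(x, y) \<in> \<Union>S" and eq: "ys = us @ x # vs" "zs = us @ y # vs"
      by (blast elim: listrel1E)
    then obtain R where R: "R \<in> S" and xy: "(x, y) \<in> R" by blast
    have R_Tol: "R \<in> Tol ar B" using R Tol by blast
    have len_zs: "length zs = ar f" using step.IH eq by simp
    have "list_all2 (\<lambda>x y. (x, y) \<in> R) ys zs"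
      using step.IH xy refl_list[OF R] unfolding eq by (simp add: list_all2_append)
    then have "(ops B f ys, ops B f zs) \<in> R" using step.IH len_zs R_Tol by (intro Tol_ops) auto
    then have "(ops B f xs, ops B f zs) \<in> (\<Union>S)\<^sup>+"
      using step.IH R by (meson UnionI trancl_into_trancl)
    moreover have "set zs \<subseteq> carr B" using step.IH eq Tol_carr[OF R_Tol xy] by simp
    ultimately show ?case using len_zs by simp
  qed
  then show ?thesis by blast
qed

lemma trancl_Union_Tol_Con:
  assumes Tol: "S \<subseteq> Tol ar B" and ne: "S \<noteq> {}"
  shows "(\<Union>S)\<^sup>+ \<in> Con ar B"
proof (intro ConI TolI)
  have "\<Union>S \<subseteq> carr B \<times> carr B" using Tol Tol_subset by fast
  then show sub: "(\<Union>S)\<^sup>+ \<subseteq> carr B \<times> carr B" by (rule trancl_subset_Sigma)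
  show "(x, x) \<in> (\<Union>S)\<^sup>+" if "x \<in> carr B" for x
  proof -
    obtain R where "R \<in> S" using ne by blast
    then have "(x, x) \<in> \<Union>S" using Tol that Tol_refl by fast
    then show ?thesis by blast
  qed
  have "sym (\<Union>S)" using Tol Tol_sym by (fast intro: symI)
  then have "sym ((\<Union>S)\<^sup>+)" by (rule sym_trancl)
  then show "(y, x) \<in> (\<Union>S)\<^sup>+" if "(x, y) \<in> (\<Union>S)\<^sup>+" for x y
    using that by (rule symD)
  show "(x, z) \<in> (\<Union>S)\<^sup>+" if "(x, y) \<in> (\<Union>S)\<^sup>+" "(y, z) \<in> (\<Union>S)\<^sup>+" for x y z
    using that by (rule trancl_trans)
  fix f xs ys
  assume "length xs = ar f" and rel: "list_all2 (\<lambda>x y. (x, y) \<in> (\<Union>S)\<^sup>+) xs ys"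
  then show "(ops B f xs, ops B f ys) \<in> (\<Union>S)\<^sup>+"
    using list_all2_carr(1)[OF sub rel] by (intro trancl_Union_Tol_ops[OF Tol ne])
qed

lemma trancl_Un_Tol_Con: "R \<in> Tol ar B \<Longrightarrow> S \<in> Tol ar B \<Longrightarrow> (R \<union> S)\<^sup>+ \<in> Con ar B"
  using trancl_Union_Tol_Con[of "{R, S}" ar B] by simp

lemma trancl_Image_subset:
  assumes "r `` X \<subseteq> X"
  shows "r\<^sup>+ `` X \<subseteq> X"
  using Image_closed_trancl[OF assms] by (auto intro: trancl_into_rtrancl)

lemma Union_chain_Con:
  assumes chain: "subset.chain (Con ar B) \<C>" and ne: "\<C> \<noteq> {}"
  shows "\<Union>\<C> \<in> Con ar B"
proof -
  have Con: "\<C> \<subseteq> Con ar B" using chain by (simp add: subset.chain_def)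
  have "trans (\<Union>\<C>)"
  proof (rule transI)
    fix x y z assume "(x, y) \<in> \<Union>\<C>" "(y, z) \<in> \<Union>\<C>"
    then obtain \<eta> \<zeta> where "\<eta> \<in> \<C>" "\<zeta> \<in> \<C>" "(x, y) \<in> \<eta>" "(y, z) \<in> \<zeta>" by blast
    moreover from this have "\<eta> \<subseteq> \<zeta> \<or> \<zeta> \<subseteq> \<eta>" using chain by (auto simp: subset.chain_def)
    ultimately obtain \<theta> where \<theta>: "\<theta> \<in> \<C>" "(x, y) \<in> \<theta>" "(y, z) \<in> \<theta>" by blast
    then have "(x, z) \<in> \<theta>" using Con Con_trans[of \<theta> ar B x y z] by blast
    then show "(x, z) \<in> \<Union>\<C>" using \<theta>(1) by blast
  qed
  moreover have "(\<Union>\<C>)\<^sup>+ \<in> Con ar B"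
    using Con ne by (intro trancl_Union_Tol_Con) (auto intro: Con_imp_Tol)
  ultimately show ?thesis by simp
qed

lemma cjoin_upper: "\<alpha> \<subseteq> cjoin ar B \<alpha> \<beta>" "\<beta> \<subseteq> cjoin ar B \<alpha> \<beta>"
  by (auto simp: cjoin_def Cg_def)

lemma cjoin_least: "\<tau> \<in> Con ar B \<Longrightarrow> \<alpha> \<subseteq> \<tau> \<Longrightarrow> \<beta> \<subseteq> \<tau> \<Longrightarrow> cjoin ar B \<alpha> \<beta> \<subseteq> \<tau>"
  unfolding cjoin_def Cg_def by blast

lemma cjoin_mono: "\<alpha> \<subseteq> \<alpha>' \<Longrightarrow> \<beta> \<subseteq> \<beta>' \<Longrightarrow> cjoin ar B \<alpha> \<beta> \<subseteq> cjoin ar B \<alpha>' \<beta>'"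
  unfolding cjoin_def Cg_def by blast


lemma cjoin_eq_trancl:
  assumes \<alpha>: "\<alpha> \<in> Con ar B" and \<beta>: "\<beta> \<in> Con ar B"
  shows "cjoin ar B \<alpha> \<beta> = (\<alpha> \<union> \<beta>)\<^sup>+"
proof
  have "(\<alpha> \<union> \<beta>)\<^sup>+ \<in> Con ar B"
    by (intro trancl_Un_Tol_Con Con_imp_Tol \<alpha> \<beta>)
  then show "cjoin ar B \<alpha> \<beta> \<subseteq> (\<alpha> \<union> \<beta>)\<^sup>+" by (rule cjoin_least) auto
  have "(\<alpha> \<union> \<beta>)\<^sup>+ \<subseteq> \<tau>" if \<tau>: "\<tau> \<in> Con ar B" "\<alpha> \<union> \<beta> \<subseteq> \<tau>" for \<tau>
    using trancl_mono_subset[OF \<tau>(2)] \<tau>(1) by (simp add: Con_iff_Tol)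
  then show "(\<alpha> \<union> \<beta>)\<^sup>+ \<subseteq> cjoin ar B \<alpha> \<beta>" unfolding cjoin_def Cg_def by blast
qed

lemma cjoin_Con: "\<alpha> \<in> Con ar B \<Longrightarrow> \<beta> \<in> Con ar B \<Longrightarrow> cjoin ar B \<alpha> \<beta> \<in> Con ar B"
  by (simp add: cjoin_eq_trancl trancl_Un_Tol_Con Con_imp_Tol)

section \<open>Homomorphisms and the correspondence theorem\<close>

definition is_hom :: "('f \<Rightarrow> nat) \<Rightarrow> ('f, 'a) alg \<Rightarrow> ('f, 'b) alg \<Rightarrow> ('a \<Rightarrow> 'b) \<Rightarrow> bool" where
  "is_hom ar C D g \<longleftrightarrow> g ` carr C \<subseteq> carr D \<and>
     (\<forall>f xs. length xs = ar f \<and> set xs \<subseteq> carr C \<longrightarrow> g (ops C f xs) = ops D f (map g xs))"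

lemma is_hom_carr: "is_hom ar C D g \<Longrightarrow> x \<in> carr C \<Longrightarrow> g x \<in> carr D"
  by (auto simp: is_hom_def)

lemma is_hom_ops:
  "is_hom ar C D g \<Longrightarrow> length xs = ar f \<Longrightarrow> set xs \<subseteq> carr C \<Longrightarrow> g (ops C f xs) = ops D f (map g xs)"
  by (simp add: is_hom_def)

lemma eval_carr:
  assumes "is_alg ar C" "range s \<subseteq> carr C" "wf_trm ar t"
  shows "eval C s t \<in> carr C"
  using assms(3)
proof (induction t)
  case (Var v)
  then show ?case using assms(2) by auto
next
  case (App f ts)
  then show ?case by (auto intro!: is_alg_ops[OF assms(1)])
qed

lemma eval_hom:
  assumes alg: "is_alg ar C" and hom: "is_hom ar C D g" and s: "range s \<subseteq> carr C"
    and wf: "wf_trm ar t"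
  shows "g (eval C s t) = eval D (g \<circ> s) t"
  using wf
proof (induction t)
  case (Var v)
  then show ?case by simp
next
  case (App f ts)
  have "set (map (eval C s) ts) \<subseteq> carr C" using App.prems eval_carr[OF alg s] by auto
  then have "g (ops C f (map (eval C s) ts)) = ops D f (map g (map (eval C s) ts))"
    using App.prems by (intro is_hom_ops[OF hom]) auto
  also have "map g (map (eval C s) ts) = map (eval D (g \<circ> s)) ts"
    using App by (simp add: comp_def)
  finally show ?case by (simp add: comp_def)
qed

definition pullback :: "('f, 'a) alg \<Rightarrow> ('a \<Rightarrow> 'b) \<Rightarrow> ('b \<times> 'b) set \<Rightarrow> ('a \<times> 'a) set" where
  "pullback C g \<theta> = {(x, y) \<in> carr C \<times> carr C. (g x, g y) \<in> \<theta>}"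

definition kernel :: "('f, 'a) alg \<Rightarrow> ('a \<Rightarrow> 'b) \<Rightarrow> ('a \<times> 'a) set" where
  "kernel C g = {(x, y) \<in> carr C \<times> carr C. g x = g y}"

lemma pullback_Con:
  assumes C: "is_alg ar C" and g: "is_hom ar C D g" and \<theta>: "\<theta> \<in> Con ar D"
  shows "pullback C g \<theta> \<in> Con ar C"
proof (intro ConI TolI)
  show sub: "pullback C g \<theta> \<subseteq> carr C \<times> carr C" by (auto simp: pullback_def)
  show "(x, x) \<in> pullback C g \<theta>" if "x \<in> carr C" for x
    using that is_hom_carr[OF g that] Con_refl[OF \<theta>] by (simp add: pullback_def)
  show "(y, x) \<in> pullback C g \<theta>" if "(x, y) \<in> pullback C g \<theta>" for x y
    using that Con_sym[OF \<theta>] by (auto simp: pullback_def)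
  show "(x, z) \<in> pullback C g \<theta>" if "(x, y) \<in> pullback C g \<theta>" "(y, z) \<in> pullback C g \<theta>" for x y z
    using that Con_trans[OF \<theta>] by (auto simp: pullback_def)
  fix f xs ys
  assume len: "length xs = ar f" "length ys = ar f"
    and rel: "list_all2 (\<lambda>x y. (x, y) \<in> pullback C g \<theta>) xs ys"
  have "list_all2 (\<lambda>x y. (x, y) \<in> \<theta>) (map g xs) (map g ys)"
    using rel by (auto simp: list_all2_map1 list_all2_map2 pullback_def elim!: list_all2_mono)
  then have "(ops D f (map g xs), ops D f (map g ys)) \<in> \<theta>"
    using Con_ops[OF \<theta>] len by simp
  then show "(ops C f xs, ops C f ys) \<in> pullback C g \<theta>"
    using is_hom_ops[OF g] len list_all2_carr[OF sub rel] is_alg_ops[OF C]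
    by (simp add: pullback_def)
qed

lemma pullback_Delta:
  assumes "g ` carr C \<subseteq> carr D"
  shows "pullback C g (Delta D) = kernel C g"
  using assms by (auto simp: pullback_def kernel_def Delta_def)

lemma kernel_Con:
  assumes "is_alg ar C" "is_alg ar D" "is_hom ar C D g"
  shows "kernel C g \<in> Con ar C"
  using pullback_Con[OF assms(1,3) Delta_Con[OF assms(2)]] assms(3)
  by (simp add: pullback_Delta is_hom_def)

definition complementary ::
  "('f \<Rightarrow> nat) \<Rightarrow> ('f, 'a) alg \<Rightarrow> ('a \<times> 'a) set \<Rightarrow> ('a \<times> 'a) set \<Rightarrow> ('a \<times> 'a) set \<Rightarrow> bool" where
  "complementary ar B \<theta> \<phi> \<psi> \<longleftrightarrow>
     \<phi> \<in> Con ar B \<and> \<psi> \<in> Con ar B \<and> \<phi> \<inter> \<psi> = \<theta> \<and> cjoin ar B \<phi> \<psi> = Nabla B"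

lemma BCon_iff_complementary: "\<phi> \<in> BCon ar B \<longleftrightarrow> (\<exists>\<psi>. complementary ar B (Delta B) \<phi> \<psi>)"
  by (auto simp: BCon_def complementary_def)

locale epimorphism =
  fixes ar :: "'f \<Rightarrow> nat" and C :: "('f, 'a) alg" and D :: "('f, 'b) alg" and g :: "'a \<Rightarrow> 'b"
  assumes alg: "is_alg ar C" and hom: "is_hom ar C D g" and surj: "g ` carr C = carr D"
begin

lemma list_preimage:
  assumes "set ys \<subseteq> carr D"
  obtains xs where "set xs \<subseteq> carr C" "ys = map g xs"
proof -
  have "ys \<in> map g ` lists (carr C)"
    using assms unfolding lists_image[symmetric] surj by auto
  then show thesis using that by auto
qed

lemma is_alg_codomain: "is_alg ar D"
  unfolding is_alg_def
proof (intro conjI allI impI)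
  show "carr D \<noteq> {}" using alg surj by (auto simp: is_alg_def)
  fix f ys assume ys: "length ys = ar f \<and> set ys \<subseteq> carr D"
  then obtain xs where "set xs \<subseteq> carr C" "ys = map g xs" using list_preimage by blast
  then have "ops D f ys = g (ops C f xs)" "ops C f xs \<in> carr C"
    using ys is_hom_ops[OF hom] is_alg_ops[OF alg] by simp_all
  then show "ops D f ys \<in> carr D" using is_hom_carr[OF hom] by simp
qed

lemma in_var_codomain:
  assumes wf: "\<forall>(s, t)\<in>E. wf_trm ar s \<and> wf_trm ar t" and C: "in_var ar E C"
  shows "in_var ar E D"
proof -
  have "eval D \<sigma> s = eval D \<sigma> t" if st: "(s, t) \<in> E" and \<sigma>: "range \<sigma> \<subseteq> carr D" for s t \<sigma>
  proof -
    define \<tau> where "\<tau> = inv_into (carr C) g \<circ> \<sigma>"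
    have \<tau>: "range \<tau> \<subseteq> carr C" "g \<circ> \<tau> = \<sigma>"
      using \<sigma> by (auto simp: \<tau>_def fun_eq_iff image_subset_iff surj
          intro!: inv_into_into f_inv_into_f)
    then have "eval C \<tau> s = eval C \<tau> t" using C st by (auto simp: in_var_def)
    then show ?thesis
      using eval_hom[OF alg hom \<tau>(1), of s] eval_hom[OF alg hom \<tau>(1), of t] wf st \<tau>(2) by auto
  qed
  then show ?thesis using is_alg_codomain by (auto simp: in_var_def)
qed

lemma kernel_le_pullback: "\<theta> \<in> Con ar D \<Longrightarrow> kernel C g \<subseteq> pullback C g \<theta>"
  using Con_refl is_hom_carr[OF hom] by (fastforce simp: kernel_def pullback_def)

lemma pullback_le_iff:
  assumes "\<alpha> \<in> Con ar D"
  shows "pullback C g \<alpha> \<subseteq> pullback C g \<beta> \<longleftrightarrow> \<alpha> \<subseteq> \<beta>"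
proof
  assume le: "pullback C g \<alpha> \<subseteq> pullback C g \<beta>"
  show "\<alpha> \<subseteq> \<beta>"
  proof (rule subrelI)
    fix X Y assume XY: "(X, Y) \<in> \<alpha>"
    then obtain x y where "x \<in> carr C" "y \<in> carr C" and eq: "X = g x" "Y = g y"
      using Con_carr[OF assms XY] surj by blast
    then have "(x, y) \<in> pullback C g \<alpha>" using XY by (simp add: pullback_def)
    then show "(X, Y) \<in> \<beta>" using le eq by (auto simp: pullback_def)
  qed
qed (auto simp: pullback_def)

lemma pullback_eq_iff:
  "\<alpha> \<in> Con ar D \<Longrightarrow> \<beta> \<in> Con ar D \<Longrightarrow> pullback C g \<alpha> = pullback C g \<beta> \<longleftrightarrow> \<alpha> = \<beta>"
  using pullback_le_iff[of \<alpha> \<beta>] pullback_le_iff[of \<beta> \<alpha>] by blast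

lemma pullback_Int: "pullback C g (\<alpha> \<inter> \<beta>) = pullback C g \<alpha> \<inter> pullback C g \<beta>"
  by (auto simp: pullback_def)

lemma pullback_Nabla: "pullback C g (Nabla D) = Nabla C"
  using is_hom_carr[OF hom] by (auto simp: pullback_def Nabla_def)

definition pushforward :: "('a \<times> 'a) set \<Rightarrow> ('b \<times> 'b) set" where
  "pushforward \<phi> = map_prod g g ` \<phi>"

lemma pushforwardE:
  assumes "(X, Y) \<in> pushforward \<phi>"
  obtains x y where "(x, y) \<in> \<phi>" "X = g x" "Y = g y"
  using assms by (auto simp: pushforward_def)

lemma pushforward_iff:
  assumes \<phi>: "\<phi> \<in> Con ar C" "kernel C g \<subseteq> \<phi>" and xy: "x \<in> carr C" "y \<in> carr C"
  shows "(g x, g y) \<in> pushforward \<phi> \<longleftrightarrow> (x, y) \<in> \<phi>"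
proof
  assume "(g x, g y) \<in> pushforward \<phi>"
  then obtain u v where uv: "(u, v) \<in> \<phi>" "g x = g u" "g y = g v" by (rule pushforwardE)
  then have "(x, u) \<in> \<phi>" "(v, y) \<in> \<phi>"
    using \<phi>(2) xy Con_carr[OF \<phi>(1) uv(1)] by (auto simp: kernel_def)
  then show "(x, y) \<in> \<phi>" using uv(1) Con_trans[OF \<phi>(1)] by blast
qed (force simp: pushforward_def)

lemma pushforward_Con:
  assumes \<phi>: "\<phi> \<in> Con ar C" "kernel C g \<subseteq> \<phi>"
  shows "pushforward \<phi> \<in> Con ar D"
proof (intro ConI TolI)
  note iff = pushforward_iff[OF \<phi>]
  show sub: "pushforward \<phi> \<subseteq> carr D \<times> carr D"
    using Con_carr[OF \<phi>(1)] is_hom_carr[OF hom] by (auto simp: pushforward_def)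
  show "(X, X) \<in> pushforward \<phi>" if "X \<in> carr D" for X
    using that iff Con_refl[OF \<phi>(1)] unfolding surj[symmetric] by blast
  show "(Y, X) \<in> pushforward \<phi>" if "(X, Y) \<in> pushforward \<phi>" for X Y
    using that Con_sym[OF \<phi>(1)] by (force simp: pushforward_def)
  show "(X, Z) \<in> pushforward \<phi>"
    if XY: "(X, Y) \<in> pushforward \<phi>" and YZ: "(Y, Z) \<in> pushforward \<phi>" for X Y Z
  proof -
    obtain x y z where "x \<in> carr C" "y \<in> carr C" "z \<in> carr C" "X = g x" "Y = g y" "Z = g z"
      using subsetD[OF sub XY] subsetD[OF sub YZ] surj by blast
    then show ?thesis using XY YZ iff Con_trans[OF \<phi>(1)] by blast
  qed
  fix f Xs Ys
  assume len: "length Xs = ar f" "length Ys = ar f"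
    and rel: "list_all2 (\<lambda>x y. (x, y) \<in> pushforward \<phi>) Xs Ys"
  obtain xs where xs: "set xs \<subseteq> carr C" "Xs = map g xs"
    using list_preimage list_all2_carr(1)[OF sub rel] by blast
  obtain ys where ys: "set ys \<subseteq> carr C" "Ys = map g ys"
    using list_preimage list_all2_carr(2)[OF sub rel] by blast
  have "list_all2 (\<lambda>x y. (x, y) \<in> \<phi>) xs ys"
    using rel xs ys iff by (auto simp: list_all2_conv_all_nth subset_iff)
  then have "(ops C f xs, ops C f ys) \<in> \<phi>"
    using len xs(2) ys(2) by (intro Con_ops[OF \<phi>(1)]) simp_all
  then show "(ops D f Xs, ops D f Ys) \<in> pushforward \<phi>"
    using is_hom_ops[OF hom, of xs f] is_hom_ops[OF hom, of ys f] xs ys len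
    by (force simp: pushforward_def)
qed

lemma pullback_pushforward:
  assumes \<phi>: "\<phi> \<in> Con ar C" "kernel C g \<subseteq> \<phi>"
  shows "pullback C g (pushforward \<phi>) = \<phi>"
  using pushforward_iff[OF \<phi>] Con_carr[OF \<phi>(1)] by (auto simp: pullback_def)

lemma pushforward_pullback:
  assumes \<theta>: "\<theta> \<in> Con ar D"
  shows "pushforward (pullback C g \<theta>) = \<theta>"
proof -
  note pb = pullback_Con[OF alg hom \<theta>] kernel_le_pullback[OF \<theta>]
  show ?thesis
    using pullback_pushforward[OF pb] pullback_eq_iff[OF pushforward_Con[OF pb] \<theta>] by blast
qed

lemma pullback_cjoin:
  assumes \<alpha>: "\<alpha> \<in> Con ar D" and \<beta>: "\<beta> \<in> Con ar D"
  shows "pullback C g (cjoin ar D \<alpha> \<beta>) = cjoin ar C (pullback C g \<alpha>) (pullback C g \<beta>)"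
    (is "_ = ?J")
proof
  have "?J \<in> Con ar C" using \<alpha> \<beta> by (intro cjoin_Con pullback_Con[OF alg hom])
  moreover have "kernel C g \<subseteq> ?J"
    using kernel_le_pullback[OF \<alpha>] cjoin_upper(1) by (rule subset_trans)
  ultimately have push: "pushforward ?J \<in> Con ar D" and pull: "pullback C g (pushforward ?J) = ?J"
    by (rule pushforward_Con, rule pullback_pushforward)
  have "cjoin ar D \<alpha> \<beta> \<subseteq> pushforward ?J"
    using pullback_le_iff[OF \<alpha>, of "pushforward ?J"] pullback_le_iff[OF \<beta>, of "pushforward ?J"]
    by (intro cjoin_least[OF push]) (simp_all add: pull cjoin_upper)
  then show "pullback C g (cjoin ar D \<alpha> \<beta>) \<subseteq> ?J"
    using pullback_le_iff[OF cjoin_Con[OF \<alpha> \<beta>], of "pushforward ?J"] by (simp add: pull)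
  show "?J \<subseteq> pullback C g (cjoin ar D \<alpha> \<beta>)"
    using \<alpha> \<beta> by (intro cjoin_least pullback_Con[OF alg hom] cjoin_Con)
      (simp_all add: pullback_le_iff cjoin_upper)
qed

lemma complementary_pullback_iff:
  assumes \<alpha>: "\<alpha> \<in> Con ar D" and \<beta>: "\<beta> \<in> Con ar D"
  shows "complementary ar C (kernel C g) (pullback C g \<alpha>) (pullback C g \<beta>) \<longleftrightarrow>
     complementary ar D (Delta D) \<alpha> \<beta>"
proof -
  have "pullback C g \<alpha> \<inter> pullback C g \<beta> = kernel C g \<longleftrightarrow> \<alpha> \<inter> \<beta> = Delta D"
    using pullback_eq_iff[OF Int_Con[OF \<alpha> \<beta>] Delta_Con[OF is_alg_codomain]] surj
    by (simp add: pullback_Delta pullback_Int)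
  moreover have "cjoin ar C (pullback C g \<alpha>) (pullback C g \<beta>) = Nabla C \<longleftrightarrow> cjoin ar D \<alpha> \<beta> = Nabla D"
    using pullback_eq_iff[OF cjoin_Con[OF \<alpha> \<beta>] Nabla_Con[OF is_alg_codomain]]
    by (simp add: pullback_cjoin[OF \<alpha> \<beta>] pullback_Nabla)
  ultimately show ?thesis
    using \<alpha> \<beta> by (simp add: complementary_def pullback_Con[OF alg hom])
qed

lemma BCon_codomain_iff:
  "\<beta> \<in> BCon ar D \<longleftrightarrow> (\<exists>\<phi> \<psi>. complementary ar C (kernel C g) \<phi> \<psi> \<and> pushforward \<phi> = \<beta>)"
proof
  assume "\<beta> \<in> BCon ar D"
  then obtain \<beta>' where compl: "complementary ar D (Delta D) \<beta> \<beta>'"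
    by (auto simp: BCon_iff_complementary)
  then have Con: "\<beta> \<in> Con ar D" "\<beta>' \<in> Con ar D" by (simp_all add: complementary_def)
  show "\<exists>\<phi> \<psi>. complementary ar C (kernel C g) \<phi> \<psi> \<and> pushforward \<phi> = \<beta>"
    using complementary_pullback_iff[OF Con] compl pushforward_pullback[OF Con(1)] by blast
next
  assume "\<exists>\<phi> \<psi>. complementary ar C (kernel C g) \<phi> \<psi> \<and> pushforward \<phi> = \<beta>"
  then obtain \<phi> \<psi> where compl: "complementary ar C (kernel C g) \<phi> \<psi>" and \<beta>: "pushforward \<phi> = \<beta>"
    by blast
  then have \<phi>: "\<phi> \<in> Con ar C" "kernel C g \<subseteq> \<phi>" and \<psi>: "\<psi> \<in> Con ar C" "kernel C g \<subseteq> \<psi>"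
    by (auto simp: complementary_def)
  then have "complementary ar D (Delta D) (pushforward \<phi>) (pushforward \<psi>)"
    using complementary_pullback_iff[OF pushforward_Con[OF \<phi>] pushforward_Con[OF \<psi>]] compl
    by (simp add: pullback_pushforward)
  then show "\<beta> \<in> BCon ar D" using \<beta> by (auto simp: BCon_iff_complementary)
qed

lemma modular_con_codomain:
  assumes "modular_con ar C"
  shows "modular_con ar D"
  unfolding modular_con_def
proof (intro ballI impI)
  fix \<alpha> \<beta> \<gamma> assume Con: "\<alpha> \<in> Con ar D" "\<beta> \<in> Con ar D" "\<gamma> \<in> Con ar D" and "\<alpha> \<subseteq> \<gamma>"
  then have "pullback C g (cjoin ar D \<alpha> (\<beta> \<inter> \<gamma>)) = pullback C g (cjoin ar D \<alpha> \<beta> \<inter> \<gamma>)"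
    using assms pullback_Con[OF alg hom] pullback_le_iff[OF Con(1)]
    by (simp add: pullback_cjoin Int_Con pullback_Int modular_con_def)
  then show "cjoin ar D \<alpha> (\<beta> \<inter> \<gamma>) = cjoin ar D \<alpha> \<beta> \<inter> \<gamma>"
    using Con by (simp add: pullback_eq_iff Int_Con cjoin_Con)
qed

end

lemma epimorphism_by_right_inverse:
  assumes alg: "is_alg ar C" and ker: "kernel C g \<in> Con ar C" and carr: "carr D = g ` carr C"
    and right_inv: "\<And>x. x \<in> carr C \<Longrightarrow> s (g x) \<in> carr C \<and> g (s (g x)) = g x"
    and ops: "\<And>f ys. ops D f ys = g (ops C f (map s ys))"
  shows "epimorphism ar C D g"
proof
  show "is_hom ar C D g"
    unfolding is_hom_def
  proof (intro conjI allI impI)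
    fix f xs assume xs: "length xs = ar f \<and> set xs \<subseteq> carr C"
    then have "list_all2 (\<lambda>x y. (x, y) \<in> kernel C g) xs (map (s \<circ> g) xs)"
      using right_inv by (auto simp: list_all2_map2 list_all2_same kernel_def subset_iff)
    from Con_ops[OF ker _ _ this, of f] show "g (ops C f xs) = ops D f (map g xs)"
      using xs by (simp add: ops kernel_def)
  qed (simp add: carr)
qed (simp_all add: alg carr)

definition image_alg :: "('a \<Rightarrow> 'b) \<Rightarrow> ('f, 'a) alg \<Rightarrow> ('f, 'b) alg" where
  "image_alg g C = \<lparr> carr = g ` carr C, ops = (\<lambda>f ys. g (ops C f (map (inv_into (carr C) g) ys))) \<rparr>"

lemma epimorphism_image_alg:
  assumes "is_alg ar C" "kernel C g \<in> Con ar C"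
  shows "epimorphism ar C (image_alg g C) g"
  by (rule epimorphism_by_right_inverse[OF assms, where s = "inv_into (carr C) g"])
    (auto simp: image_alg_def intro: inv_into_into f_inv_into_f)

lemma epimorphism_inv_into:
  assumes "epimorphism ar C D g" and inj: "inj_on g (carr C)"
  shows "epimorphism ar D C (inv_into (carr C) g)"
proof -
  interpret epimorphism ar C D g by fact
  have "is_hom ar D C (inv_into (carr C) g)"
    unfolding is_hom_def
  proof (intro conjI allI impI)
    show "inv_into (carr C) g ` carr D \<subseteq> carr C" using surj by (auto intro: inv_into_into)
    fix f ys assume ys: "length ys = ar f \<and> set ys \<subseteq> carr D"
    then obtain xs where xs: "set xs \<subseteq> carr C" "ys = map g xs" using list_preimage by blast
    have "map (inv_into (carr C) g) ys = xs"
      using xs inj by (auto simp: map_idI subset_iff)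
    then show "inv_into (carr C) g (ops D f ys) = ops C f (map (inv_into (carr C) g) ys)"
      using xs ys inj is_hom_ops[OF hom, of xs f] is_alg_ops[OF alg, of xs f]
      by (metis inv_into_f_f length_map)
  qed
  moreover have "inv_into (carr C) g ` carr D = carr C"
    using inj by (simp add: surj[symmetric])
  ultimately show ?thesis using is_alg_codomain by unfold_locales
qed

section \<open>Boolean lifting in the congruence lattice\<close>

lemma Con_class_eq_iff:
  assumes "\<theta> \<in> Con ar A" "x \<in> carr A" "y \<in> carr A"
  shows "\<theta> `` {x} = \<theta> `` {y} \<longleftrightarrow> (x, y) \<in> \<theta>"
  using assms by (intro eq_equiv_class_iff) (auto simp: Con_def)

lemma kernel_class:
  assumes "\<theta> \<in> Con ar A"
  shows "kernel A (\<lambda>x. \<theta> `` {x}) = \<theta>"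
  using Con_class_eq_iff[OF assms] Con_carr[OF assms] by (auto simp: kernel_def)

lemma epimorphism_quot_alg:
  assumes alg: "is_alg ar A" and \<theta>: "\<theta> \<in> Con ar A"
  shows "epimorphism ar A (quot_alg A \<theta>) (\<lambda>x. \<theta> `` {x})"
proof (rule epimorphism_by_right_inverse[OF alg, where s = "\<lambda>X. SOME x. x \<in> X"])
  show "kernel A (\<lambda>x. \<theta> `` {x}) \<in> Con ar A" using \<theta> by (simp add: kernel_class)
  show "carr (quot_alg A \<theta>) = (\<lambda>x. \<theta> `` {x}) ` carr A"
    by (auto simp: quot_alg_def quotient_def)
  fix x assume x: "x \<in> carr A"
  have "(x, SOME y. y \<in> \<theta> `` {x}) \<in> \<theta>"
    using someI[of "\<lambda>y. y \<in> \<theta> `` {x}" x] Con_refl[OF \<theta> x] by simp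
  then show "(SOME y. y \<in> \<theta> `` {x}) \<in> carr A \<and> \<theta> `` {SOME y. y \<in> \<theta> `` {x}} = \<theta> `` {x}"
    using x Con_carr[OF \<theta>] Con_class_eq_iff[OF \<theta>] by metis
qed (simp add: quot_alg_def)

context
  fixes ar :: "'f \<Rightarrow> nat" and A :: "('f, 'a) alg" and \<theta> :: "('a \<times> 'a) set"
  assumes alg: "is_alg ar A" and \<theta>: "\<theta> \<in> Con ar A"
begin

interpretation quot: epimorphism ar A "quot_alg A \<theta>" "\<lambda>x. \<theta> `` {x}"
  by (rule epimorphism_quot_alg[OF alg \<theta>])

lemma quot_con_eq_pushforward: "quot_con \<theta> \<phi> = quot.pushforward \<phi>"
  by (auto simp: quot_con_def quot.pushforward_def)

lemma quot_con_eq_iff: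
  assumes "\<phi> \<in> Con ar A" "\<theta> \<subseteq> \<phi>" "\<psi> \<in> Con ar A" "\<theta> \<subseteq> \<psi>"
  shows "quot_con \<theta> \<phi> = quot_con \<theta> \<psi> \<longleftrightarrow> \<phi> = \<psi>"
  using assms quot.pullback_pushforward unfolding quot_con_eq_pushforward kernel_class[OF \<theta>] by metis

lemma BCon_quot_alg_iff:
  "\<beta> \<in> BCon ar (quot_alg A \<theta>) \<longleftrightarrow> (\<exists>\<phi> \<psi>. complementary ar A \<theta> \<phi> \<psi> \<and> quot_con \<theta> \<phi> = \<beta>)"
  by (simp add: quot.BCon_codomain_iff kernel_class[OF \<theta>] quot_con_eq_pushforward)

lemma CBLP_iff_complementary:
  "CBLP ar A \<theta> \<longleftrightarrow>
     (\<forall>\<phi> \<psi>. complementary ar A \<theta> \<phi> \<psi> \<longrightarrow>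
        (\<exists>\<alpha> \<alpha>'. complementary ar A (Delta A) \<alpha> \<alpha>' \<and> cjoin ar A \<alpha> \<theta> = \<phi>))"
  (is "_ \<longleftrightarrow> ?lift")
proof
  assume cblp: "CBLP ar A \<theta>"
  show ?lift
  proof (intro allI impI)
    fix \<phi> \<psi> assume compl: "complementary ar A \<theta> \<phi> \<psi>"
    then have \<phi>: "\<phi> \<in> Con ar A" "\<theta> \<subseteq> \<phi>" by (auto simp: complementary_def)
    have "quot_con \<theta> \<phi> \<in> BCon ar (quot_alg A \<theta>)" using compl BCon_quot_alg_iff by metis
    then obtain \<alpha> where \<alpha>: "\<alpha> \<in> BCon ar A" and eq: "quot_con \<theta> (cjoin ar A \<alpha> \<theta>) = quot_con \<theta> \<phi>"
      using cblp unfolding CBLP_def by metis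
    have "cjoin ar A \<alpha> \<theta> \<in> Con ar A" using \<alpha> \<theta> by (auto simp: BCon_def intro: cjoin_Con)
    then have "cjoin ar A \<alpha> \<theta> = \<phi>" using quot_con_eq_iff[OF _ cjoin_upper(2) \<phi>] eq by metis
    then show "\<exists>\<alpha> \<alpha>'. complementary ar A (Delta A) \<alpha> \<alpha>' \<and> cjoin ar A \<alpha> \<theta> = \<phi>"
      using \<alpha> unfolding BCon_iff_complementary by metis
  qed
next
  assume lift: ?lift
  show "CBLP ar A \<theta>"
    unfolding CBLP_def
  proof
    fix \<beta> assume "\<beta> \<in> BCon ar (quot_alg A \<theta>)"
    then obtain \<phi> \<psi> where compl: "complementary ar A \<theta> \<phi> \<psi>" and \<beta>: "quot_con \<theta> \<phi> = \<beta>"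
      unfolding BCon_quot_alg_iff by metis
    obtain \<alpha> \<alpha>' where \<alpha>: "complementary ar A (Delta A) \<alpha> \<alpha>'" and "cjoin ar A \<alpha> \<theta> = \<phi>"
      using lift compl by metis
    then have "quot_con \<theta> (cjoin ar A \<alpha> \<theta>) = \<beta>" using \<beta> by simp
    then show "\<exists>\<alpha>\<in>BCon ar A. quot_con \<theta> (cjoin ar A \<alpha> \<theta>) = \<beta>"
      using \<alpha> BCon_iff_complementary by metis
  qed
qed

end

section \<open>The algebra of pairs of a congruence\<close>

definition sub_prod :: "('f, 'a) alg \<Rightarrow> ('f, 'b) alg \<Rightarrow> ('a \<times> 'b) set \<Rightarrow> ('f, 'a \<times> 'b) alg" where
  "sub_prod C D S = \<lparr> carr = S, ops = (\<lambda>f zs. (ops C f (map fst zs), ops D f (map snd zs))) \<rparr>"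

lemma carr_sub_prod [simp]: "carr (sub_prod C D S) = S"
  by (simp add: sub_prod_def)

lemma ops_sub_prod [simp]: "ops (sub_prod C D S) f zs = (ops C f (map fst zs), ops D f (map snd zs))"
  by (simp add: sub_prod_def)

lemma eval_sub_prod: "eval (sub_prod C D S) s t = (eval C (fst \<circ> s) t, eval D (snd \<circ> s) t)"
proof (induction t)
  case (Var v)
  then show ?case by simp
next
  case (App f ts)
  then have "map fst (map (eval (sub_prod C D S) s) ts) = map (eval C (fst \<circ> s)) ts"
    "map snd (map (eval (sub_prod C D S) s) ts) = map (eval D (snd \<circ> s)) ts"
    by (simp_all add: comp_def)
  then show ?case by (simp add: comp_def del: map_map)
qed

lemma in_var_sub_prod:
  assumes C: "in_var ar E C" and D: "in_var ar E D" and S: "S \<subseteq> carr C \<times> carr D"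
    and alg: "is_alg ar (sub_prod C D S)"
  shows "in_var ar E (sub_prod C D S)"
proof -
  have "eval (sub_prod C D S) \<sigma> s = eval (sub_prod C D S) \<sigma> t"
    if st: "(s, t) \<in> E" and \<sigma>: "range \<sigma> \<subseteq> S" for s t \<sigma>
  proof -
    have "range (fst \<circ> \<sigma>) \<subseteq> carr C" "range (snd \<circ> \<sigma>) \<subseteq> carr D"
      using subset_trans[OF \<sigma> S] by (auto simp: image_subset_iff mem_Times_iff)
    then show ?thesis using C D st unfolding in_var_def eval_sub_prod by blast
  qed
  then show ?thesis using alg by (auto simp: in_var_def)
qed

lemma is_hom_fst: "S \<subseteq> carr C \<times> carr D \<Longrightarrow> is_hom ar (sub_prod C D S) C fst"
  by (auto simp: is_hom_def)

lemma is_hom_snd: "S \<subseteq> carr C \<times> carr D \<Longrightarrow> is_hom ar (sub_prod C D S) D snd"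
  by (auto simp: is_hom_def)

lemma shifting:
  assumes mod: "modular_con ar B"
    and \<eta>: "\<eta> \<in> Con ar B" and \<zeta>: "\<zeta> \<in> Con ar B" and \<gamma>: "\<gamma> \<in> Con ar B" and meet: "\<eta> \<inter> \<zeta> \<subseteq> \<gamma>"
    and xy: "(x, y) \<in> \<eta>" and uz: "(u, z) \<in> \<eta>" "(u, z) \<in> \<gamma>"
    and xu: "(x, u) \<in> \<zeta>" and yz: "(y, z) \<in> \<zeta>"
  shows "(x, y) \<in> \<gamma>"
proof -
  let ?J = "cjoin ar B (\<gamma> \<inter> \<eta>) \<zeta>"
  have J: "?J \<in> Con ar B" by (intro cjoin_Con Int_Con \<gamma> \<eta> \<zeta>)
  have "(x, u) \<in> ?J" using xu cjoin_upper(2) by (rule rev_subsetD)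
  moreover have "(u, z) \<in> ?J" using uz cjoin_upper(1)[of "\<gamma> \<inter> \<eta>"] by blast
  moreover have "(z, y) \<in> ?J" using Con_sym[OF \<zeta> yz] cjoin_upper(2) by (rule rev_subsetD)
  ultimately have "(x, y) \<in> ?J \<inter> \<eta>" using xy Con_trans[OF J] by blast
  also have "?J \<inter> \<eta> = cjoin ar B (\<gamma> \<inter> \<eta>) (\<zeta> \<inter> \<eta>)"
    using mod \<eta> \<zeta> Int_Con[OF \<gamma> \<eta>] by (simp add: modular_con_def)
  also have "\<dots> \<subseteq> \<gamma>" using meet by (intro cjoin_least[OF \<gamma>]) auto
  finally show ?thesis .
qed

definition square_con :: "('a \<times> 'a) set \<Rightarrow> ('a \<times> 'a) set \<Rightarrow> (('a \<times> 'a) \<times> ('a \<times> 'a)) set" where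
  "square_con \<alpha> \<theta> = {((a, c), (b, d)). (a, c) \<in> \<alpha> \<and> (b, d) \<in> \<alpha> \<and> (a, b) \<in> \<theta> \<and> (c, d) \<in> \<theta>}"

definition square_join ::
  "('f \<Rightarrow> nat) \<Rightarrow> ('f, 'a) alg \<Rightarrow> ('a \<times> 'a) set \<Rightarrow> ('a \<times> 'a) set \<Rightarrow> ('a \<times> 'a) set \<Rightarrow>
     (('a \<times> 'a) \<times> ('a \<times> 'a)) set" where
  "square_join ar A \<alpha> \<beta> \<chi> = cjoin ar (sub_prod A A \<alpha>) (square_con \<alpha> \<beta>) (square_con \<alpha> \<chi>)"

text \<open>A pair ((a, c), (b, d)) of D is read as the matrix with columns (a, c) and (b, d).\<close>
definition transposed ::
  "('a \<times> 'a) set \<Rightarrow> (('a \<times> 'a) \<times> ('a \<times> 'a)) set \<Rightarrow> (('a \<times> 'a) \<times> ('a \<times> 'a)) set" where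
  "transposed \<psi> D = {((a, b), (c, d)). (a, b) \<in> \<psi> \<and> (c, d) \<in> \<psi> \<and> ((a, c), (b, d)) \<in> D}"

context
  fixes ar :: "'f \<Rightarrow> nat" and A :: "('f, 'a) alg" and \<alpha> :: "('a \<times> 'a) set"
  assumes alg: "is_alg ar A" and \<alpha>: "\<alpha> \<in> Con ar A"
begin

lemma is_alg_pairs: "is_alg ar (sub_prod A A \<alpha>)"
  unfolding is_alg_def
proof (intro conjI allI impI)
  show "carr (sub_prod A A \<alpha>) \<noteq> {}" using alg Con_refl[OF \<alpha>] by (fastforce simp: is_alg_def)
  fix f and zs :: "('a \<times> 'a) list"
  assume "length zs = ar f \<and> set zs \<subseteq> carr (sub_prod A A \<alpha>)"
  then show "ops (sub_prod A A \<alpha>) f zs \<in> carr (sub_prod A A \<alpha>)"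
    using Con_ops[OF \<alpha>, of "map fst zs" f "map snd zs"]
    by (auto simp: list_all2_map1 list_all2_map2 list_all2_same)
qed

lemma pullback_fst_Con: "\<theta> \<in> Con ar A \<Longrightarrow> pullback (sub_prod A A \<alpha>) fst \<theta> \<in> Con ar (sub_prod A A \<alpha>)"
  by (rule pullback_Con[OF is_alg_pairs is_hom_fst[OF Con_subset[OF \<alpha>]]])

lemma pullback_snd_Con: "\<theta> \<in> Con ar A \<Longrightarrow> pullback (sub_prod A A \<alpha>) snd \<theta> \<in> Con ar (sub_prod A A \<alpha>)"
  by (rule pullback_Con[OF is_alg_pairs is_hom_snd[OF Con_subset[OF \<alpha>]]])

lemma kernel_fst_Con: "kernel (sub_prod A A \<alpha>) fst \<in> Con ar (sub_prod A A \<alpha>)"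
  by (rule kernel_Con[OF is_alg_pairs alg is_hom_fst[OF Con_subset[OF \<alpha>]]])

lemma kernel_snd_Con: "kernel (sub_prod A A \<alpha>) snd \<in> Con ar (sub_prod A A \<alpha>)"
  by (rule kernel_Con[OF is_alg_pairs alg is_hom_snd[OF Con_subset[OF \<alpha>]]])

lemma is_hom_diagonal: "is_hom ar A (sub_prod A A \<alpha>) (\<lambda>x. (x, x))"
  using Con_refl[OF \<alpha>] by (auto simp: is_hom_def comp_def)

lemma is_hom_swap: "is_hom ar (sub_prod A A \<alpha>) (sub_prod A A \<alpha>) prod.swap"
  using Con_sym[OF \<alpha>] by (auto simp: is_hom_def comp_def)

lemma square_con_Con:
  assumes "\<theta> \<in> Con ar A"
  shows "square_con \<alpha> \<theta> \<in> Con ar (sub_prod A A \<alpha>)"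
proof -
  have "square_con \<alpha> \<theta> = pullback (sub_prod A A \<alpha>) fst \<theta> \<inter> pullback (sub_prod A A \<alpha>) snd \<theta>"
    by (auto simp: square_con_def pullback_def)
  then show ?thesis using assms by (simp add: Int_Con pullback_fst_Con pullback_snd_Con)
qed

lemma square_join_Con:
  "\<beta> \<in> Con ar A \<Longrightarrow> \<chi> \<in> Con ar A \<Longrightarrow> square_join ar A \<alpha> \<beta> \<chi> \<in> Con ar (sub_prod A A \<alpha>)"
  unfolding square_join_def by (intro cjoin_Con square_con_Con)

lemma square_con_le_square_join:
  "square_con \<alpha> \<beta> \<subseteq> square_join ar A \<alpha> \<beta> \<chi>" "square_con \<alpha> \<chi> \<subseteq> square_join ar A \<alpha> \<beta> \<chi>"
  unfolding square_join_def by (rule cjoin_upper)+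

lemma square_join_diagonal:
  assumes \<beta>: "\<beta> \<in> Con ar A" and \<chi>: "\<chi> \<in> Con ar A" and xy: "(x, y) \<in> cjoin ar A \<beta> \<chi>"
  shows "((x, x), (y, y)) \<in> square_join ar A \<alpha> \<beta> \<chi>" (is "_ \<in> ?D")
proof -
  have "\<theta> \<subseteq> pullback A (\<lambda>x. (x, x)) ?D" if \<theta>: "\<theta> \<in> Con ar A" and le: "square_con \<alpha> \<theta> \<subseteq> ?D" for \<theta>
  proof (rule subrelI)
    fix x y assume xy: "(x, y) \<in> \<theta>"
    then have "((x, x), (y, y)) \<in> square_con \<alpha> \<theta>"
      using Con_carr[OF \<theta> xy] Con_refl[OF \<alpha>] by (simp add: square_con_def)
    then show "(x, y) \<in> pullback A (\<lambda>x. (x, x)) ?D"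
      using le Con_carr[OF \<theta> xy] by (auto simp: pullback_def)
  qed
  from this[OF \<beta> square_con_le_square_join(1)] this[OF \<chi> square_con_le_square_join(2)]
  have "cjoin ar A \<beta> \<chi> \<subseteq> pullback A (\<lambda>x. (x, x)) ?D"
    by (intro cjoin_least pullback_Con[OF alg is_hom_diagonal] square_join_Con \<beta> \<chi>)
  then show ?thesis using xy by (auto simp: pullback_def)
qed

lemma square_join_swap:
  assumes \<beta>: "\<beta> \<in> Con ar A" and \<chi>: "\<chi> \<in> Con ar A"
    and acbd: "((a, c), (b, d)) \<in> square_join ar A \<alpha> \<beta> \<chi>"
  shows "((c, a), (d, b)) \<in> square_join ar A \<alpha> \<beta> \<chi>" (is "_ \<in> ?D")
proof -
  have "square_con \<alpha> \<theta> \<subseteq> pullback (sub_prod A A \<alpha>) prod.swap ?D" if "square_con \<alpha> \<theta> \<subseteq> ?D" for \<theta>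
    using that Con_sym[OF \<alpha>] by (auto simp: square_con_def pullback_def)
  from this[OF square_con_le_square_join(1)] this[OF square_con_le_square_join(2)]
  have "?D \<subseteq> pullback (sub_prod A A \<alpha>) prod.swap ?D"
    using cjoin_least[OF pullback_Con[OF is_alg_pairs is_hom_swap square_join_Con[OF \<beta> \<chi>]]]
    by (subst square_join_def) blast
  then show ?thesis using acbd by (auto simp: pullback_def)
qed

lemma square_join_saturates:
  assumes mod: "modular_con ar A" and \<beta>: "\<beta> \<in> Con ar A" and \<chi>: "\<chi> \<in> Con ar A"
    and meet: "\<alpha> \<inter> \<beta> \<subseteq> \<chi>"
  shows "square_join ar A \<alpha> \<beta> \<chi> `` \<chi> \<subseteq> \<chi>"
proof -
  have "(b, d) \<in> \<chi>" if "((a, c), (b, d)) \<in> square_con \<alpha> \<beta>" "(a, c) \<in> \<chi>" for a b c d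
    using that shifting[OF mod \<alpha> \<beta> \<chi> meet, of b d a c] Con_sym[OF \<beta>]
    by (simp add: square_con_def)
  moreover have "(b, d) \<in> \<chi>" if "((a, c), (b, d)) \<in> square_con \<alpha> \<chi>" "(a, c) \<in> \<chi>" for a b c d
    using that Con_sym[OF \<chi>, of a b] Con_trans[OF \<chi>] unfolding square_con_def by blast
  ultimately have "(square_con \<alpha> \<beta> \<union> square_con \<alpha> \<chi>) `` \<chi> \<subseteq> \<chi>" by auto
  then show ?thesis
    unfolding square_join_def cjoin_eq_trancl[OF square_con_Con[OF \<beta>] square_con_Con[OF \<chi>]]
    by (rule trancl_Image_subset)
qed

context
  fixes D :: "(('a \<times> 'a) \<times> ('a \<times> 'a)) set"
  assumes mod: "modular_con ar (sub_prod A A \<alpha>)" and D: "D \<in> Con ar (sub_prod A A \<alpha>)"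
begin

lemma Con_pairs_change_fst:
  assumes yzw: "((y, z), (y, w)) \<in> D" and xy: "(x, y) \<in> \<alpha>"
  shows "((x, z), (x, w)) \<in> D"
proof (rule shifting[OF mod kernel_fst_Con kernel_snd_Con D])
  have "(y, z) \<in> \<alpha>" "(y, w) \<in> \<alpha>" using Con_carr[OF D yzw] by simp_all
  moreover from this have "(x, z) \<in> \<alpha>" "(x, w) \<in> \<alpha>" using Con_trans[OF \<alpha> xy] by blast+
  ultimately show "((x, z), (x, w)) \<in> kernel (sub_prod A A \<alpha>) fst"
    "((y, z), (y, w)) \<in> kernel (sub_prod A A \<alpha>) fst"
    "((x, z), (y, z)) \<in> kernel (sub_prod A A \<alpha>) snd"
    "((x, w), (y, w)) \<in> kernel (sub_prod A A \<alpha>) snd"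
    by (simp_all add: kernel_def)
  show "kernel (sub_prod A A \<alpha>) fst \<inter> kernel (sub_prod A A \<alpha>) snd \<subseteq> D"
    using Con_refl[OF D] by (auto simp: kernel_def)
qed (rule yzw)

text \<open>This takes the place of the symmetry of the commutator.\<close>
lemma saturates_transposed:
  assumes \<chi>: "\<chi> \<in> Con ar A" and sat: "D `` \<chi> \<subseteq> \<chi>"
    and acbd: "((a, c), (b, d)) \<in> D" and aabb: "((a, a), (b, b)) \<in> D" and ab: "(a, b) \<in> \<chi>"
  shows "(c, d) \<in> \<chi>"
proof -
  have "((a, c), (b, d)) \<in> pullback (sub_prod A A \<alpha>) snd \<chi>"
  proof (rule shifting[OF mod D kernel_fst_Con pullback_snd_Con[OF \<chi>] _ acbd aabb])
    show "D \<inter> kernel (sub_prod A A \<alpha>) fst \<subseteq> pullback (sub_prod A A \<alpha>) snd \<chi>"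
    proof (rule subsetI)
      fix p assume p: "p \<in> D \<inter> kernel (sub_prod A A \<alpha>) fst"
      then obtain x y z where eq: "p = ((x, y), (x, z))" by (auto simp: kernel_def)
      then have xyz: "(x, y) \<in> \<alpha>" "(x, z) \<in> \<alpha>" using p by (auto simp: kernel_def)
      have "((x, y), (x, z)) \<in> D" using p eq by simp
      then have "((y, y), (y, z)) \<in> D" using Con_sym[OF \<alpha> xyz(1)] by (rule Con_pairs_change_fst)
      moreover have "(y, y) \<in> \<chi>" using Con_carr[OF \<alpha> xyz(1)] Con_refl[OF \<chi>] by blast
      ultimately have "(y, z) \<in> \<chi>" using sat by blast
      then show "p \<in> pullback (sub_prod A A \<alpha>) snd \<chi>" using xyz by (simp add: pullback_def eq)
    qed
  qed (use Con_carr[OF D acbd] Con_carr[OF D aabb] ab in \<open>auto simp: kernel_def pullback_def\<close>)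
  then show ?thesis by (simp add: pullback_def)
qed

end

end

lemma transposed_Tol:
  assumes D: "D \<in> Con ar (sub_prod A A \<alpha>)" and \<psi>: "\<psi> \<in> Con ar A"
    and diag: "\<And>x y. (x, y) \<in> \<psi> \<Longrightarrow> ((x, x), (y, y)) \<in> D"
    and swap: "\<And>a b c d. ((a, c), (b, d)) \<in> D \<Longrightarrow> ((c, a), (d, b)) \<in> D"
  shows "transposed \<psi> D \<in> Tol ar (sub_prod A A \<psi>)"
proof (rule TolI)
  fix f and zs ws :: "('a \<times> 'a) list"
  assume len: "length zs = ar f" "length ws = ar f"
    and rel: "list_all2 (\<lambda>x y. (x, y) \<in> transposed \<psi> D) zs ws"
  have nth: "zs ! i \<in> \<psi>" "ws ! i \<in> \<psi>"
    "((fst (zs ! i), fst (ws ! i)), (snd (zs ! i), snd (ws ! i))) \<in> D" if "i < ar f" for i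
    using rel len that by (auto simp: list_all2_conv_all_nth transposed_def case_prod_unfold)
  have "list_all2 (\<lambda>x y. (x, y) \<in> D) (zip (map fst zs) (map fst ws)) (zip (map snd zs) (map snd ws))"
    using nth(3) len by (simp add: list_all2_conv_all_nth)
  from Con_ops[OF D _ _ this, of f] len
  have "((ops A f (map fst zs), ops A f (map fst ws)), (ops A f (map snd zs), ops A f (map snd ws))) \<in> D"
    by simp
  moreover have "list_all2 (\<lambda>x y. (x, y) \<in> \<psi>) (map fst zs) (map snd zs)"
    "list_all2 (\<lambda>x y. (x, y) \<in> \<psi>) (map fst ws) (map snd ws)"
    using nth(1,2) len by (auto simp: list_all2_conv_all_nth)
  then have "(ops A f (map fst zs), ops A f (map snd zs)) \<in> \<psi>"
    "(ops A f (map fst ws), ops A f (map snd ws)) \<in> \<psi>"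
    using len by (auto intro!: Con_ops[OF \<psi>])
  ultimately show "(ops (sub_prod A A \<psi>) f zs, ops (sub_prod A A \<psi>) f ws) \<in> transposed \<psi> D"
    by (simp add: transposed_def)
qed (use diag swap in \<open>auto simp: transposed_def\<close>)

text \<open>The term condition for [\<alpha>, \<psi>] \<subseteq> \<chi>.\<close>
lemma ex_centralizing_Tol:
  assumes alg: "is_alg ar A" and mod: "modular_con ar A" "modular_con ar (sub_prod A A \<alpha>)"
    and \<alpha>: "\<alpha> \<in> Con ar A" and \<beta>: "\<beta> \<in> Con ar A" and \<chi>: "\<chi> \<in> Con ar A" and meet: "\<alpha> \<inter> \<beta> \<subseteq> \<chi>"
    and \<psi>: "\<psi> \<in> Con ar A" and le: "\<psi> \<subseteq> cjoin ar A \<beta> \<chi>"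
  obtains R where "R \<in> Tol ar (sub_prod A A \<psi>)"
    and "\<And>x y. (x, y) \<in> \<alpha> \<Longrightarrow> ((x, x), (y, y)) \<in> R" and "R `` \<chi> \<subseteq> \<chi>"
proof -
  define D where "D = square_join ar A \<alpha> \<beta> \<chi>"
  have D: "D \<in> Con ar (sub_prod A A \<alpha>)" unfolding D_def by (rule square_join_Con[OF alg \<alpha> \<beta> \<chi>])
  have diag: "((x, x), (y, y)) \<in> D" if "(x, y) \<in> \<psi>" for x y
    unfolding D_def using square_join_diagonal[OF alg \<alpha> \<beta> \<chi>] le that by blast
  have swap: "((c, a), (d, b)) \<in> D" if "((a, c), (b, d)) \<in> D" for a b c d
    using that unfolding D_def by (rule square_join_swap[OF alg \<alpha> \<beta> \<chi>])
  have sat: "D `` \<chi> \<subseteq> \<chi>" unfolding D_def by (rule square_join_saturates[OF alg \<alpha> mod(1) \<beta> \<chi> meet])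
  show thesis
  proof (rule that)
    show "transposed \<psi> D \<in> Tol ar (sub_prod A A \<psi>)" by (rule transposed_Tol[OF D \<psi> diag swap])
    show "((x, x), (y, y)) \<in> transposed \<psi> D" if "(x, y) \<in> \<alpha>" for x y
      using that Con_refl[OF D] Con_carr[OF \<alpha> that] Con_refl[OF \<psi>] by (simp add: transposed_def)
    show "transposed \<psi> D `` \<chi> \<subseteq> \<chi>"
      using saturates_transposed[OF alg \<alpha> mod(2) D \<chi> sat] diag by (auto simp: transposed_def)
  qed
qed

section \<open>Congruence modular semidegenerate varieties\<close>

lemma kernel_inj_SOME:
  assumes \<kappa>: "\<kappa> \<in> Con ar C" and h: "inj h"
  shows "kernel C (\<lambda>x. h (SOME y. (x, y) \<in> \<kappa>)) = \<kappa>"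
proof -
  have some: "(x, SOME y. (x, y) \<in> \<kappa>) \<in> \<kappa>" if "x \<in> carr C" for x
    using Con_refl[OF \<kappa> that] by (rule someI)
  have "(SOME z. (x, z) \<in> \<kappa>) = (SOME z. (y, z) \<in> \<kappa>) \<longleftrightarrow> (x, y) \<in> \<kappa>"
    if xy: "x \<in> carr C" "y \<in> carr C" for x y
  proof
    assume "(SOME z. (x, z) \<in> \<kappa>) = (SOME z. (y, z) \<in> \<kappa>)"
    then show "(x, y) \<in> \<kappa>" using some xy Con_sym[OF \<kappa>] Con_trans[OF \<kappa>] by metis
  next
    assume "(x, y) \<in> \<kappa>"
    then have "(x, z) \<in> \<kappa> \<longleftrightarrow> (y, z) \<in> \<kappa>" for z using Con_sym[OF \<kappa>] Con_trans[OF \<kappa>] by blast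
    then show "(SOME z. (x, z) \<in> \<kappa>) = (SOME z. (y, z) \<in> \<kappa>)" by simp
  qed
  then show ?thesis using Con_subset[OF \<kappa>] h by (auto simp: kernel_def inj_eq)
qed

locale cm_semidegenerate =
  fixes ar :: "'f \<Rightarrow> nat"
    and E :: "(('f, nat) trm \<times> ('f, nat) trm) set"
    and A :: "('f, 'u) alg"
  assumes finite_signature: "finite (UNIV :: 'f set)"
    and wf_E: "\<forall>(s, t)\<in>E. wf_trm ar s \<and> wf_trm ar t"
    and infinite_universe: "infinite (UNIV :: 'u set)"
    and modular: "\<forall>B :: ('f, 'u) alg. in_var ar E B \<longrightarrow> modular_con ar B"
    and semidegenerate: "\<forall>B :: ('f, 'u) alg. in_var ar E B \<and> nontrivial B \<longrightarrow> \<not> one_elem_subalg ar B"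
    and A: "in_var ar E A"
begin

lemma alg_A: "is_alg ar A"
  using A by (simp add: in_var_def)

lemma ex_inj_pair: "\<exists>h :: 'u \<times> 'u \<Rightarrow> 'u. inj h"
  using card_of_Times_same_infinite[OF infinite_universe]
    card_of_ordIso[of "UNIV \<times> UNIV :: ('u \<times> 'u) set" "UNIV :: 'u set"]
  by (auto simp: bij_betw_def)

lemma modular_con_if_inj:
  fixes C :: "('f, 'c) alg" and h :: "'c \<Rightarrow> 'u"
  assumes C: "in_var ar E C" and h: "inj h"
  shows "modular_con ar C"
proof -
  have alg: "is_alg ar C" using C by (simp add: in_var_def)
  have "kernel C h = Delta C" using h by (auto simp: kernel_def Delta_def inj_eq)
  then have epi: "epimorphism ar C (image_alg h C) h"
    using alg by (simp add: epimorphism_image_alg Delta_Con)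
  then have "in_var ar E (image_alg h C)" using wf_E C by (rule epimorphism.in_var_codomain)
  then have mod: "modular_con ar (image_alg h C)" using modular by blast
  have "epimorphism ar (image_alg h C) C (inv_into (carr C) h)"
    by (rule epimorphism_inv_into[OF epi inj_on_subset[OF h subset_UNIV]])
  then show ?thesis using mod by (rule epimorphism.modular_con_codomain)
qed

lemma Con_eq_Nabla_if_idempotent_class:
  fixes C :: "('f, 'c) alg" and h :: "'c \<Rightarrow> 'u"
  assumes C: "in_var ar E C" and h: "inj h" and \<kappa>: "\<kappa> \<in> Con ar C"
    and x: "x \<in> carr C" and idem: "\<And>f. (ops C f (replicate (ar f) x), x) \<in> \<kappa>"
  shows "\<kappa> = Nabla C"
proof -
  define g where "g = (\<lambda>x. h (SOME y. (x, y) \<in> \<kappa>))"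
  have ker: "kernel C g = \<kappa>" unfolding g_def using \<kappa> h by (rule kernel_inj_SOME)
  have alg: "is_alg ar C" using C by (simp add: in_var_def)
  interpret epimorphism ar C "image_alg g C" g
    using alg \<kappa> by (simp add: epimorphism_image_alg ker)
  have "ops (image_alg g C) f (replicate (ar f) (g x)) = g x" for f
  proof -
    have "g (ops C f (replicate (ar f) x)) = ops (image_alg g C) f (replicate (ar f) (g x))"
      using is_hom_ops[OF hom, of "replicate (ar f) x" f] x
      by (simp add: set_replicate_conv_if map_replicate)
    moreover have "g (ops C f (replicate (ar f) x)) = g x"
      using idem[of f] unfolding ker[symmetric] by (simp add: kernel_def)
    ultimately show ?thesis by simp
  qed
  then have "one_elem_subalg ar (image_alg g C)"
    using is_hom_carr[OF hom x] by (auto simp: one_elem_subalg_def)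
  then have "\<not> nontrivial (image_alg g C)"
    using semidegenerate in_var_codomain[OF wf_E C] by blast
  then have "g y = g z" if "y \<in> carr C" "z \<in> carr C" for y z
    using that is_hom_carr[OF hom] unfolding nontrivial_def by blast
  then have "Nabla C \<subseteq> kernel C g" by (auto simp: Nabla_def kernel_def)
  then show ?thesis using \<kappa> by (simp add: ker Con_eq_Nabla)
qed

lemma Union_chain_neq_Nabla:
  assumes chain: "subset.chain (Con ar A) \<C>" and ne: "\<C> \<noteq> {}" and proper: "Nabla A \<notin> \<C>"
  shows "\<Union>\<C> \<noteq> Nabla A"
proof
  assume full: "\<Union>\<C> = Nabla A"
  obtain x where x: "x \<in> carr A" using alg_A by (auto simp: is_alg_def)
  let ?F = "range (\<lambda>f. (ops A f (replicate (ar f) x), x))"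
  have "ops A f (replicate (ar f) x) \<in> carr A" for f
    using x by (intro is_alg_ops[OF alg_A]) auto
  then have "?F \<subseteq> \<Union>\<C>" using x by (auto simp: full Nabla_def)
  moreover have "finite ?F" using finite_signature by simp
  ultimately obtain \<tau> where \<tau>: "\<tau> \<in> \<C>" "?F \<subseteq> \<tau>"
    using finite_subset_Union_chain[OF _ _ ne chain] by metis
  then have Con: "\<tau> \<in> Con ar A" using chain by (auto simp: subset.chain_def)
  have "\<tau> = Nabla A"
    using \<tau>(2) by (intro Con_eq_Nabla_if_idempotent_class[OF A inj_on_id Con x]) auto
  then show False using \<tau>(1) proper by blast
qed

lemma ex_MaxCon:
  assumes \<theta>: "\<theta> \<in> Con ar A" "\<theta> \<noteq> Nabla A"
  obtains \<mu> where "\<mu> \<in> MaxCon ar A" "\<theta> \<subseteq> \<mu>"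
proof -
  define \<A> where "\<A> = {\<tau> \<in> Con ar A. \<theta> \<subseteq> \<tau> \<and> \<tau> \<noteq> Nabla A}"
  have "\<exists>M\<in>\<A>. \<forall>X\<in>\<A>. M \<subseteq> X \<longrightarrow> X = M"
  proof (rule subset_Zorn_nonempty)
    show "\<A> \<noteq> {}" using \<theta> by (auto simp: \<A>_def)
    fix \<C> assume ne: "\<C> \<noteq> {}" and "subset.chain \<A> \<C>"
    then have chain: "subset.chain (Con ar A) \<C>" and sub: "\<C> \<subseteq> \<A>"
      by (auto simp: subset.chain_def \<A>_def)
    have "\<Union>\<C> \<noteq> Nabla A"
      using Union_chain_neq_Nabla[OF chain ne] sub by (auto simp: \<A>_def)
    moreover have "\<theta> \<subseteq> \<Union>\<C>" using ne sub by (auto simp: \<A>_def)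
    ultimately show "\<Union>\<C> \<in> \<A>" using Union_chain_Con[OF chain ne] by (simp add: \<A>_def)
  qed
  then obtain \<mu> where \<mu>: "\<mu> \<in> \<A>" "\<forall>X\<in>\<A>. \<mu> \<subseteq> X \<longrightarrow> X = \<mu>" by blast
  then have "\<mu> \<in> MaxCon ar A" by (auto simp: MaxCon_def \<A>_def)
  then show thesis using that \<mu>(1) by (simp add: \<A>_def)
qed

lemma eq_Nabla_if_cjoin_eq_Nabla_same_MaxCon:
  assumes max_eq: "{\<mu> \<in> MaxCon ar A. \<theta> \<subseteq> \<mu>} = {\<mu> \<in> MaxCon ar A. \<chi> \<subseteq> \<mu>}"
    and \<tau>: "\<tau> \<in> Con ar A" "\<theta> \<subseteq> \<tau>" and join: "cjoin ar A \<tau> \<chi> = Nabla A"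
  shows "\<tau> = Nabla A"
proof (rule ccontr)
  assume "\<tau> \<noteq> Nabla A"
  then obtain \<mu> where \<mu>: "\<mu> \<in> MaxCon ar A" "\<tau> \<subseteq> \<mu>" using ex_MaxCon[OF \<tau>(1)] by blast
  then have Con: "\<mu> \<in> Con ar A" "\<mu> \<noteq> Nabla A" by (simp_all add: MaxCon_def)
  have "\<chi> \<subseteq> \<mu>" using \<mu> \<tau>(2) max_eq by blast
  then have "Nabla A \<subseteq> \<mu>" using cjoin_least[OF Con(1) \<mu>(2), of \<chi>] join by simp
  then show False using Con Con_eq_Nabla by blast
qed

lemma in_var_pairs:
  assumes "\<sigma> \<in> Con ar A"
  shows "in_var ar E (sub_prod A A \<sigma>)"
  using in_var_sub_prod[OF A A Con_subset[OF assms] is_alg_pairs[OF alg_A assms]] .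

lemma modular_con_pairs: "\<sigma> \<in> Con ar A \<Longrightarrow> modular_con ar (sub_prod A A \<sigma>)"
  using ex_inj_pair in_var_pairs modular_con_if_inj by blast

text \<open>This replaces the identity [\<psi>, \<nabla>] = \<psi> of commutator theory.\<close>
lemma diagonal_collapse:
  assumes \<psi>: "\<psi> \<in> Con ar A" and \<kappa>: "\<kappa> \<in> Con ar (sub_prod A A \<psi>)"
    and diag: "\<And>x y. x \<in> carr A \<Longrightarrow> y \<in> carr A \<Longrightarrow> ((x, x), (y, y)) \<in> \<kappa>"
  shows "\<kappa> = \<psi> \<times> \<psi>"
proof -
  obtain x where x: "x \<in> carr A" using alg_A by (auto simp: is_alg_def)
  obtain h :: "'u \<times> 'u \<Rightarrow> 'u" where h: "inj h" using ex_inj_pair by blast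
  have "\<kappa> = Nabla (sub_prod A A \<psi>)"
  proof (rule Con_eq_Nabla_if_idempotent_class[OF in_var_pairs[OF \<psi>] h \<kappa>])
    show "(x, x) \<in> carr (sub_prod A A \<psi>)" using Con_refl[OF \<psi> x] by simp
    fix f
    have "ops A f (replicate (ar f) x) \<in> carr A" using x by (intro is_alg_ops[OF alg_A]) auto
    then show "(ops (sub_prod A A \<psi>) f (replicate (ar f) (x, x)), (x, x)) \<in> \<kappa>"
      using diag x by (simp add: map_replicate)
  qed
  then show ?thesis by (simp add: Nabla_def)
qed

lemma le_if_Tol_saturate:
  assumes \<psi>: "\<psi> \<in> Con ar A" and \<chi>: "\<chi> \<in> Con ar A"
    and \<alpha>: "\<alpha> \<in> Con ar A" and \<beta>: "\<beta> \<in> Con ar A" and join: "cjoin ar A \<alpha> \<beta> = Nabla A"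
    and R: "R \<in> Tol ar (sub_prod A A \<psi>)" "\<And>x y. (x, y) \<in> \<alpha> \<Longrightarrow> ((x, x), (y, y)) \<in> R" "R `` \<chi> \<subseteq> \<chi>"
    and S: "S \<in> Tol ar (sub_prod A A \<psi>)" "\<And>x y. (x, y) \<in> \<beta> \<Longrightarrow> ((x, x), (y, y)) \<in> S" "S `` \<chi> \<subseteq> \<chi>"
  shows "\<psi> \<subseteq> \<chi>"
proof (rule subrelI)
  have Con: "(R \<union> S)\<^sup>+ \<in> Con ar (sub_prod A A \<psi>)" using R(1) S(1) by (rule trancl_Un_Tol_Con)
  have "cjoin ar A \<alpha> \<beta> \<subseteq> pullback A (\<lambda>x. (x, x)) ((R \<union> S)\<^sup>+)"
    using R(2) S(2) Con_carr[OF \<alpha>] Con_carr[OF \<beta>]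
    by (intro cjoin_least pullback_Con[OF alg_A is_hom_diagonal[OF alg_A \<psi>] Con])
      (auto simp: pullback_def)
  then have full: "(R \<union> S)\<^sup>+ = \<psi> \<times> \<psi>"
    unfolding join by (intro diagonal_collapse[OF \<psi> Con]) (auto simp: pullback_def Nabla_def)
  have saturated: "(R \<union> S)\<^sup>+ `` \<chi> \<subseteq> \<chi>" using R(3) S(3) by (intro trancl_Image_subset) blast
  fix x y assume xy: "(x, y) \<in> \<psi>"
  then have x: "x \<in> carr A" using Con_carr[OF \<psi>] by blast
  have "((x, x), (x, y)) \<in> (R \<union> S)\<^sup>+" unfolding full using xy Con_refl[OF \<psi> x] by simp
  then show "(x, y) \<in> \<chi>" using saturated Con_refl[OF \<chi> x] by blast
qed

lemma comaximal_distrib: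
  assumes \<alpha>: "\<alpha> \<in> Con ar A" and \<beta>: "\<beta> \<in> Con ar A" and \<chi>: "\<chi> \<in> Con ar A"
    and meet: "\<alpha> \<inter> \<beta> \<subseteq> \<chi>" and join: "cjoin ar A \<alpha> \<beta> = Nabla A"
  shows "cjoin ar A \<alpha> \<chi> \<inter> cjoin ar A \<beta> \<chi> = \<chi>"
proof
  define \<psi> where "\<psi> = cjoin ar A \<alpha> \<chi> \<inter> cjoin ar A \<beta> \<chi>"
  have \<psi>: "\<psi> \<in> Con ar A" unfolding \<psi>_def by (intro Int_Con cjoin_Con \<alpha> \<beta> \<chi>)
  have le: "\<psi> \<subseteq> cjoin ar A \<beta> \<chi>" "\<psi> \<subseteq> cjoin ar A \<alpha> \<chi>" by (auto simp: \<psi>_def)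
  have mod: "modular_con ar A" using modular A by blast
  obtain R where R: "R \<in> Tol ar (sub_prod A A \<psi>)" "\<And>x y. (x, y) \<in> \<alpha> \<Longrightarrow> ((x, x), (y, y)) \<in> R"
    "R `` \<chi> \<subseteq> \<chi>"
    using ex_centralizing_Tol[OF alg_A mod modular_con_pairs[OF \<alpha>] \<alpha> \<beta> \<chi> meet \<psi> le(1)] by blast
  have "\<beta> \<inter> \<alpha> \<subseteq> \<chi>" using meet by blast
  then obtain S where S: "S \<in> Tol ar (sub_prod A A \<psi>)" "\<And>x y. (x, y) \<in> \<beta> \<Longrightarrow> ((x, x), (y, y)) \<in> S"
    "S `` \<chi> \<subseteq> \<chi>"
    using ex_centralizing_Tol[OF alg_A mod modular_con_pairs[OF \<beta>] \<beta> \<alpha> \<chi> _ \<psi> le(2)] by blast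
  show "cjoin ar A \<alpha> \<chi> \<inter> cjoin ar A \<beta> \<chi> \<subseteq> \<chi>"
    using le_if_Tol_saturate[OF \<psi> \<chi> \<alpha> \<beta> join R S] by (simp add: \<psi>_def)
  show "\<chi> \<subseteq> cjoin ar A \<alpha> \<chi> \<inter> cjoin ar A \<beta> \<chi>" using cjoin_upper(2) by blast
qed

lemma complementary_cjoin:
  assumes compl: "complementary ar A \<theta> \<phi> \<psi>" and \<chi>: "\<chi> \<in> Con ar A" and le: "\<theta> \<subseteq> \<chi>"
  shows "complementary ar A \<chi> (cjoin ar A \<phi> \<chi>) (cjoin ar A \<psi> \<chi>)"
proof -
  have \<phi>: "\<phi> \<in> Con ar A" and \<psi>: "\<psi> \<in> Con ar A" and meet: "\<phi> \<inter> \<psi> \<subseteq> \<chi>"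
    and join: "cjoin ar A \<phi> \<psi> = Nabla A"
    using compl le by (simp_all add: complementary_def)
  let ?J = "cjoin ar A (cjoin ar A \<phi> \<chi>) (cjoin ar A \<psi> \<chi>)"
  have "cjoin ar A \<phi> \<psi> \<subseteq> ?J" by (intro cjoin_mono cjoin_upper)
  then have "?J = Nabla A" unfolding join by (intro Con_eq_Nabla[of _ ar] cjoin_Con \<phi> \<psi> \<chi>)
  then show ?thesis
    using comaximal_distrib[OF \<phi> \<psi> \<chi> meet join]
    by (simp add: complementary_def cjoin_Con \<phi> \<psi> \<chi>)
qed

lemma le_if_le_cjoin_same_MaxCon:
  assumes \<chi>: "\<chi> \<in> Con ar A"
    and max_eq: "{\<mu> \<in> MaxCon ar A. \<theta> \<subseteq> \<mu>} = {\<mu> \<in> MaxCon ar A. \<chi> \<subseteq> \<mu>}"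
    and compl: "complementary ar A \<delta> \<alpha> \<beta>"
    and \<tau>: "\<tau> \<in> Con ar A" "\<delta> \<subseteq> \<tau>" "\<theta> \<subseteq> \<tau>" and le: "\<alpha> \<subseteq> cjoin ar A \<tau> \<chi>"
  shows "\<alpha> \<subseteq> \<tau>"
proof -
  have \<alpha>: "\<alpha> \<in> Con ar A" and \<beta>: "\<beta> \<in> Con ar A" and meet: "\<alpha> \<inter> \<beta> \<subseteq> \<tau>"
    and join: "cjoin ar A \<alpha> \<beta> = Nabla A"
    using compl \<tau>(2) by (simp_all add: complementary_def)
  have \<beta>\<tau>: "cjoin ar A \<beta> \<tau> \<in> Con ar A" by (intro cjoin_Con \<beta> \<tau>)
  let ?J = "cjoin ar A (cjoin ar A \<beta> \<tau>) \<chi>"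
  have J: "?J \<in> Con ar A" by (intro cjoin_Con \<beta>\<tau> \<chi>)
  have "\<alpha> \<subseteq> ?J" using le cjoin_mono[OF cjoin_upper(2) subset_refl] by (rule subset_trans)
  moreover have "\<beta> \<subseteq> ?J" using cjoin_upper(1) cjoin_upper(1) by (rule subset_trans)
  ultimately have "Nabla A \<subseteq> ?J" unfolding join[symmetric] by (rule cjoin_least[OF J])
  then have "?J = Nabla A" by (rule Con_eq_Nabla[OF J])
  moreover have "\<theta> \<subseteq> cjoin ar A \<beta> \<tau>" using \<tau>(3) cjoin_upper(2) by (rule subset_trans)
  ultimately have "cjoin ar A \<beta> \<tau> = Nabla A"
    using eq_Nabla_if_cjoin_eq_Nabla_same_MaxCon[OF max_eq \<beta>\<tau>] by blast
  then have "\<alpha> \<subseteq> cjoin ar A \<alpha> \<tau> \<inter> cjoin ar A \<beta> \<tau>"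
    using cjoin_upper(1) Con_le_Nabla[OF \<alpha>] by simp
  then show ?thesis using comaximal_distrib[OF \<alpha> \<beta> \<tau>(1) meet join] by simp
qed

lemma CBLP_if_same_MaxCon:
  assumes \<theta>: "\<theta> \<in> Con ar A" and \<chi>: "\<chi> \<in> Con ar A" and le: "\<theta> \<subseteq> \<chi>"
    and max_eq: "{\<mu> \<in> MaxCon ar A. \<theta> \<subseteq> \<mu>} = {\<mu> \<in> MaxCon ar A. \<chi> \<subseteq> \<mu>}"
    and cblp: "CBLP ar A \<chi>"
  shows "CBLP ar A \<theta>"
  unfolding CBLP_iff_complementary[OF alg_A \<theta>]
proof (intro allI impI)
  fix \<phi> \<psi> assume \<phi>\<psi>: "complementary ar A \<theta> \<phi> \<psi>"
  then have \<phi>: "\<phi> \<in> Con ar A" "\<theta> \<subseteq> \<phi>" by (auto simp: complementary_def)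
  obtain \<gamma> \<gamma>' where \<gamma>\<gamma>': "complementary ar A (Delta A) \<gamma> \<gamma>'"
    and same: "cjoin ar A \<gamma> \<chi> = cjoin ar A \<phi> \<chi>"
    using cblp complementary_cjoin[OF \<phi>\<psi> \<chi> le] CBLP_iff_complementary[OF alg_A \<chi>] by blast
  then have \<gamma>: "\<gamma> \<in> Con ar A" by (simp add: complementary_def)
  have \<gamma>\<theta>: "cjoin ar A \<gamma> \<theta> \<in> Con ar A" by (intro cjoin_Con \<gamma> \<theta>)
  note reflect_le = le_if_le_cjoin_same_MaxCon[OF \<chi> max_eq]
  have "\<gamma> \<subseteq> \<phi>"
    using cjoin_upper(1)[of \<gamma> ar A \<chi>] same
    by (intro reflect_le[OF \<gamma>\<gamma>' \<phi>(1) Delta_le_Con[OF \<phi>(1)] \<phi>(2)]) simp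
  moreover have "\<phi> \<subseteq> cjoin ar A \<gamma> \<theta>"
  proof (rule reflect_le[OF \<phi>\<psi> \<gamma>\<theta> cjoin_upper(2) cjoin_upper(2)])
    have "cjoin ar A \<gamma> \<chi> \<subseteq> cjoin ar A (cjoin ar A \<gamma> \<theta>) \<chi>"
      by (intro cjoin_mono cjoin_upper subset_refl)
    then show "\<phi> \<subseteq> cjoin ar A (cjoin ar A \<gamma> \<theta>) \<chi>" using same cjoin_upper(1)[of \<phi> ar A \<chi>] by simp
  qed
  ultimately have "cjoin ar A \<gamma> \<theta> = \<phi>" using cjoin_least[OF \<phi>(1) _ \<phi>(2)] by blast
  then show "\<exists>\<alpha> \<alpha>'. complementary ar A (Delta A) \<alpha> \<alpha>' \<and> cjoin ar A \<alpha> \<theta> = \<phi>" using \<gamma>\<gamma>' by blast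
qed

end

theorem theorem5p12:
  fixes ar :: "'f \<Rightarrow> nat"
    and E :: "(('f, nat) trm \<times> ('f, nat) trm) set"
    and A :: "('f, 'u) alg"
    and \<theta> \<chi> :: "('u \<times> 'u) set"
  assumes fin_sig: "finite (UNIV :: 'f set)"
    and wf_E: "\<forall>(s, t)\<in>E. wf_trm ar s \<and> wf_trm ar t"
    and big_universe: "infinite (UNIV :: 'u set)"
    and cm: "\<forall>B :: ('f, 'u) alg. in_var ar E B \<longrightarrow> modular_con ar B"
    and semideg: "\<forall>B :: ('f, 'u) alg. in_var ar E B \<and> nontrivial B \<longrightarrow> \<not> one_elem_subalg ar B"
    and K_comm: "\<forall>B :: ('f, 'u) alg. in_var ar E B \<longrightarrow>
                   (\<forall>\<alpha>\<in>K ar B. \<forall>\<beta>\<in>K ar B. comm ar B \<alpha> \<beta> \<in> K ar B)"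
    and ret_bc: "\<forall>B :: ('f, 'u) alg. in_var ar E B \<longrightarrow> ret_preserves_bc ar B"
    and A_in: "in_var ar E A"
    and \<theta>_con: "\<theta> \<in> Con ar A"
    and \<chi>_con: "\<chi> \<in> Con ar A"
    and sub: "\<theta> \<subseteq> \<chi>"
    and max_eq: "{\<mu> \<in> MaxCon ar A. \<theta> \<subseteq> \<mu>} = {\<mu> \<in> MaxCon ar A. \<chi> \<subseteq> \<mu>}"
    and cblp: "CBLP ar A \<chi>"
  shows "CBLP ar A \<theta>"
proof -
  interpret cm_semidegenerate ar E A
    by unfold_locales (fact fin_sig wf_E big_universe cm semideg A_in)+
  show ?thesis using \<theta>_con \<chi>_con sub max_eq cblp by (rule CBLP_if_same_MaxCon)
qed

end
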